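(* There is no unital conditional expectation from $\mathcal{Q}_2$ onto $\mathcal{O}_2$.
   Context: The $2$-adic ring $C^*$-algebra $\mathcal{Q}_2$ is the universal (unital) $C^*$-algebra generated by a unitary $U$ and an isometry $S_2$ satisfying $S_2U=U^2S_2$ and $S_2S_2^*+US_2S_2^*U^*=1$. Put $S_1:=US_2$. The Cuntz algebra $\mathcal{O}_2$ is regarded as the $C^*$-subalgebra $C^*(S_1,S_2)\subset\mathcal{Q}_2$. *)

theory Defs
  imports "HOL-Analysis.Analysis"
begin

section \<open>Unital C*-algebras\<close>

class unital_star_algebra = ring + monoid_mult +
  fixes scaleC :: "complex \<Rightarrow> 'a \<Rightarrow> 'a" (infixr "*\<^sub>C" 75)
    and adj :: "'a \<Rightarrow> 'a"
  assumes scaleC_add_right: "c *\<^sub>C (x + y) = c *\<^sub>C x + c *\<^sub>C y"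
    and scaleC_add_left: "(c + d) *\<^sub>C x = c *\<^sub>C x + d *\<^sub>C x"
    and scaleC_scaleC: "c *\<^sub>C d *\<^sub>C x = (c * d) *\<^sub>C x"
    and scaleC_one: "1 *\<^sub>C x = x"
    and mult_scaleC_left: "(c *\<^sub>C x) * y = c *\<^sub>C (x * y)"
    and mult_scaleC_right: "x * (c *\<^sub>C y) = c *\<^sub>C (x * y)"
    and adj_adj: "adj (adj x) = x"
    and adj_add: "adj (x + y) = adj x + adj y"
    and adj_mult: "adj (x * y) = adj y * adj x"
    and adj_scaleC: "adj (c *\<^sub>C x) = cnj c *\<^sub>C adj x"

text \<open>The real scalar multiplication required by the library class \<open>banach\<close> is the restriction
  of the complex one. The zero algebra is not excluded.\<close>

class unital_cstar_algebra = unital_star_algebra + real_normed_algebra + banach +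
  assumes scaleR_scaleC: "r *\<^sub>R x = complex_of_real r *\<^sub>C x"
    and norm_scaleC: "norm (c *\<^sub>C x) = cmod c * norm x"
    and cstar_identity: "norm (adj x * x) = (norm x)\<^sup>2"

definition unital_star_hom :: "('a::unital_star_algebra \<Rightarrow> 'b::unital_star_algebra) \<Rightarrow> bool" where
  "unital_star_hom f \<longleftrightarrow>
     f 1 = 1 \<and> (\<forall>x y. f (x + y) = f x + f y) \<and> (\<forall>x y. f (x * y) = f x * f y) \<and>
     (\<forall>c x. f (c *\<^sub>C x) = c *\<^sub>C f x) \<and> (\<forall>x. f (adj x) = adj (f x))"

definition cstar_subalgebra :: "'a::unital_cstar_algebra set \<Rightarrow> bool" where
  "cstar_subalgebra B \<longleftrightarrow>
     closed B \<and> 0 \<in> B \<and> (\<forall>x\<in>B. \<forall>y\<in>B. x + y \<in> B \<and> x * y \<in> B) \<and>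
     (\<forall>c. \<forall>x\<in>B. c *\<^sub>C x \<in> B) \<and> (\<forall>x\<in>B. adj x \<in> B)"

definition cstar_generated :: "'a::unital_cstar_algebra set \<Rightarrow> 'a set" where
  "cstar_generated X = \<Inter>{B. cstar_subalgebra B \<and> X \<subseteq> B}"

definition positive :: "'a::unital_cstar_algebra \<Rightarrow> bool" where
  "positive a \<longleftrightarrow> (\<exists>x. a = adj x * x)"

text \<open>A conditional expectation is a positive linear projection onto the subalgebra that is a
  bimodule map over it. For unital maps, contractivity and complete positivity, which some
  authors list as well, follow from these conditions; conversely, projections of norm one satisfy
  all of them (Tomiyama).\<close>

definition conditional_expectation ::
    "'a::unital_cstar_algebra set \<Rightarrow> ('a \<Rightarrow> 'a) \<Rightarrow> bool" where
  "conditional_expectation B E \<longleftrightarrow>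
     (\<forall>x y. E (x + y) = E x + E y) \<and> (\<forall>c x. E (c *\<^sub>C x) = c *\<^sub>C E x) \<and>
     (\<forall>x. positive x \<longrightarrow> positive (E x)) \<and>
     range E = B \<and> (\<forall>b\<in>B. E b = b) \<and>
     (\<forall>b\<in>B. \<forall>b'\<in>B. \<forall>x. E (b * x * b') = b * E x * b')"

section \<open>The universal *-algebra of the relations\<close>

text \<open>*-polynomials in two letters, and the congruence generated by the axioms of unital *-algebras
  together with the defining relations of the 2-adic ring C*-algebra.\<close>

datatype q2_term =
    TU | TS | TZero | TOne
  | TAdd q2_term q2_term | TNeg q2_term | TMul q2_term q2_term
  | TScale complex q2_term | TAdj q2_term

inductive q2_eq :: "q2_term \<Rightarrow> q2_term \<Rightarrow> bool" where
  q2_refl: "q2_eq a a"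
| q2_sym: "q2_eq a b \<Longrightarrow> q2_eq b a"
| q2_trans: "q2_eq a b \<Longrightarrow> q2_eq b c \<Longrightarrow> q2_eq a c"
| q2_cong_add: "q2_eq a a' \<Longrightarrow> q2_eq b b' \<Longrightarrow> q2_eq (TAdd a b) (TAdd a' b')"
| q2_cong_neg: "q2_eq a a' \<Longrightarrow> q2_eq (TNeg a) (TNeg a')"
| q2_cong_mul: "q2_eq a a' \<Longrightarrow> q2_eq b b' \<Longrightarrow> q2_eq (TMul a b) (TMul a' b')"
| q2_cong_scale: "q2_eq a a' \<Longrightarrow> q2_eq (TScale c a) (TScale c a')"
| q2_cong_adj: "q2_eq a a' \<Longrightarrow> q2_eq (TAdj a) (TAdj a')"
| q2_add_assoc: "q2_eq (TAdd (TAdd x y) z) (TAdd x (TAdd y z))"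
| q2_add_comm: "q2_eq (TAdd x y) (TAdd y x)"
| q2_add_zero: "q2_eq (TAdd TZero x) x"
| q2_add_neg: "q2_eq (TAdd (TNeg x) x) TZero"
| q2_mul_assoc: "q2_eq (TMul (TMul x y) z) (TMul x (TMul y z))"
| q2_one_mul: "q2_eq (TMul TOne x) x"
| q2_mul_one: "q2_eq (TMul x TOne) x"
| q2_distr: "q2_eq (TMul (TAdd x y) z) (TAdd (TMul x z) (TMul y z))"
| q2_distl: "q2_eq (TMul x (TAdd y z)) (TAdd (TMul x y) (TMul x z))"
| q2_scale_add: "q2_eq (TScale c (TAdd x y)) (TAdd (TScale c x) (TScale c y))"
| q2_add_scale: "q2_eq (TScale (c + d) x) (TAdd (TScale c x) (TScale d x))"
| q2_scale_scale: "q2_eq (TScale c (TScale d x)) (TScale (c * d) x)"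
| q2_scale_one: "q2_eq (TScale 1 x) x"
| q2_scale_left: "q2_eq (TMul (TScale c x) y) (TScale c (TMul x y))"
| q2_scale_right: "q2_eq (TMul x (TScale c y)) (TScale c (TMul x y))"
| q2_adj_adj: "q2_eq (TAdj (TAdj x)) x"
| q2_adj_add: "q2_eq (TAdj (TAdd x y)) (TAdd (TAdj x) (TAdj y))"
| q2_adj_mul: "q2_eq (TAdj (TMul x y)) (TMul (TAdj y) (TAdj x))"
| q2_adj_scale: "q2_eq (TAdj (TScale c x)) (TScale (cnj c) (TAdj x))"
| q2_U_isometry: "q2_eq (TMul (TAdj TU) TU) TOne"
| q2_U_coisometry: "q2_eq (TMul TU (TAdj TU)) TOne"
| q2_S_isometry: "q2_eq (TMul (TAdj TS) TS) TOne"
| q2_commutation: "q2_eq (TMul TS TU) (TMul (TMul TU TU) TS)"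
| q2_ranges: "q2_eq (TAdd (TMul TS (TAdj TS))
      (TMul (TMul (TMul TU TS) (TAdj TS)) (TAdj TU))) TOne"

quotient_type q2_alg = q2_term / q2_eq
  by (rule equivpI) (auto simp: reflp_def symp_def transp_def intro: q2_refl q2_sym q2_trans)

instantiation q2_alg :: unital_star_algebra
begin
lift_definition zero_q2_alg :: q2_alg is TZero .
lift_definition one_q2_alg :: q2_alg is TOne .
lift_definition plus_q2_alg :: "q2_alg \<Rightarrow> q2_alg \<Rightarrow> q2_alg" is TAdd by (rule q2_cong_add)
lift_definition uminus_q2_alg :: "q2_alg \<Rightarrow> q2_alg" is TNeg by (rule q2_cong_neg)
lift_definition minus_q2_alg :: "q2_alg \<Rightarrow> q2_alg \<Rightarrow> q2_alg" is "\<lambda>x y. TAdd x (TNeg y)"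
  by (intro q2_cong_add q2_cong_neg)
lift_definition times_q2_alg :: "q2_alg \<Rightarrow> q2_alg \<Rightarrow> q2_alg" is TMul by (rule q2_cong_mul)
lift_definition scaleC_q2_alg :: "complex \<Rightarrow> q2_alg \<Rightarrow> q2_alg" is TScale by (rule q2_cong_scale)
lift_definition adj_q2_alg :: "q2_alg \<Rightarrow> q2_alg" is TAdj by (rule q2_cong_adj)
instance
  by standard (transfer; intro q2_eq.intros(1,9-27))+
end

lift_definition alg_U :: q2_alg is TU .
lift_definition alg_S :: q2_alg is TS .

text \<open>A C*-seminorm: submultiplicative and satisfying the C*-identity. The universal C*-algebra is
  the separated completion of the universal *-algebra for the largest C*-seminorm.\<close>

definition cstar_seminorm :: "('a::unital_star_algebra \<Rightarrow> real) \<Rightarrow> bool" where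
  "cstar_seminorm p \<longleftrightarrow>
     (\<forall>x. 0 \<le> p x) \<and> (\<forall>x y. p (x + y) \<le> p x + p y) \<and> (\<forall>c x. p (c *\<^sub>C x) = cmod c * p x) \<and>
     (\<forall>x y. p (x * y) \<le> p x * p y) \<and> (\<forall>x. p (adj x * x) = (p x)\<^sup>2)"

definition q2_norm :: "q2_alg \<Rightarrow> real" where
  "q2_norm x = (SUP p\<in>{p. cstar_seminorm p}. p x)"

lemma scaleC_zero_left [simp]: "0 *\<^sub>C x = (0::'a::unital_star_algebra)"
  using scaleC_add_left[of 0 0 x] by simp

lemma scaleC_zero_right [simp]: "c *\<^sub>C 0 = (0::'a::unital_star_algebra)"
  using scaleC_add_right[of c 0 0] by simp

lemma scaleC_minus_one: "(-1) *\<^sub>C x = - (x::'a::unital_star_algebra)"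
  using scaleC_add_left[of "-1" 1 x] by (simp add: scaleC_one eq_neg_iff_add_eq_0)

lemma scaleC_minus_left: "(-c) *\<^sub>C x = - (c *\<^sub>C (x::'a::unital_star_algebra))"
  using scaleC_add_left[of "-c" c x] by (simp add: eq_neg_iff_add_eq_0)

lemma scaleC_minus_right: "c *\<^sub>C (- x) = - (c *\<^sub>C (x::'a::unital_star_algebra))"
  using scaleC_add_right[of c "-x" x] by (simp add: eq_neg_iff_add_eq_0)

lemma scaleC_diff_right: "c *\<^sub>C (x - y) = c *\<^sub>C x - c *\<^sub>C (y::'a::unital_star_algebra)"
  using scaleC_add_right[of c x "-y"] by (simp add: scaleC_minus_right)

lemma adj_zero [simp]: "adj 0 = (0::'a::unital_star_algebra)"
  using adj_add[of 0 0] by simp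

lemma adj_one [simp]: "adj 1 = (1::'a::unital_star_algebra)"
  by (metis adj_adj adj_mult mult_1_left)

lemma adj_minus: "adj (- x) = - adj (x::'a::unital_star_algebra)"
  using adj_add[of "-x" x] by (simp add: eq_neg_iff_add_eq_0)

lemma adj_diff: "adj (x - y) = adj x - adj (y::'a::unital_star_algebra)"
  using adj_add[of x "-y"] by (simp add: adj_minus)

lemma cstar_seminorm_norm: "cstar_seminorm (norm :: 'a::unital_cstar_algebra \<Rightarrow> real)"
  by (simp add: cstar_seminorm_def norm_triangle_ineq norm_scaleC norm_mult_ineq cstar_identity)

lemma cstar_seminormD:
  assumes "cstar_seminorm p"
  shows "0 \<le> p x" "p (x + y) \<le> p x + p y" "p (c *\<^sub>C x) = cmod c * p x"
    "p (x * y) \<le> p x * p y" "p (adj x * x) = (p x)\<^sup>2"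
  using assms by (auto simp: cstar_seminorm_def)

lemma cstar_seminorm_adj:
  assumes "cstar_seminorm p" shows "p (adj x) = p x"
proof -
  have *: "p y \<le> p (adj y)" for y
  proof (cases "p y = 0")
    case False
    have "p y * p y \<le> p (adj y) * p y"
      using cstar_seminormD(4)[OF assms, of "adj y" y] cstar_seminormD(5)[OF assms, of y]
      by (simp add: power2_eq_square)
    then show ?thesis
      using False cstar_seminormD(1)[OF assms, of y] by (simp add: mult_le_cancel_right)
  qed (use cstar_seminormD(1)[OF assms] in auto)
  show ?thesis using *[of x] *[of "adj x"] by (simp add: adj_adj)
qed

lemma norm_adj: "norm (adj x) = norm (x::'a::unital_cstar_algebra)"
  by (rule cstar_seminorm_adj[OF cstar_seminorm_norm])

lemma cstar_seminorm_one:
  assumes "cstar_seminorm p" shows "p 1 \<le> 1"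
proof -
  have "p 1 = (p 1)\<^sup>2" using cstar_seminormD(5)[OF assms, of 1] by simp
  then show ?thesis by (auto simp: power2_eq_square)
qed

lemma cstar_seminorm_isometry:
  assumes "cstar_seminorm p" "adj v * v = 1" shows "p v \<le> 1"
proof -
  have "(p v)\<^sup>2 \<le> 1" 
    using cstar_seminormD(5)[OF assms(1), of v] cstar_seminorm_one[OF assms(1)] assms(2) by simp
  then show ?thesis by (simp add: power2_le_iff_abs_le abs_le_iff abs_square_le_1)
qed

lemma alg_U_isometry: "adj alg_U * alg_U = 1"
  and alg_U_coisometry: "alg_U * adj alg_U = 1"
  and alg_S_isometry: "adj alg_S * alg_S = 1"
  and alg_commutation: "alg_S * alg_U = alg_U * alg_U * alg_S"
  and alg_ranges: "alg_S * adj alg_S + alg_U * alg_S * adj alg_S * adj alg_U = 1"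
  by (transfer, rule q2_U_isometry q2_U_coisometry q2_S_isometry q2_commutation q2_ranges)+

lemma q2_alg_induct [case_names U S zero one add minus mult scale adj]:
  assumes "P alg_U" "P alg_S" "P 0" "P 1" "\<And>x y. P x \<Longrightarrow> P y \<Longrightarrow> P (x + y)"
    "\<And>x. P x \<Longrightarrow> P (- x)" "\<And>x y. P x \<Longrightarrow> P y \<Longrightarrow> P (x * y)" "\<And>c x. P x \<Longrightarrow> P (c *\<^sub>C x)"
    "\<And>x. P x \<Longrightarrow> P (adj x)"
  shows "P x"
proof -
  have "P (abs_q2_alg t)" for t
    by (induction t)
      (use assms in \<open>simp_all add: alg_U.abs_eq[symmetric] alg_S.abs_eq[symmetric]
        zero_q2_alg.abs_eq[symmetric] one_q2_alg.abs_eq[symmetric] plus_q2_alg.abs_eq[symmetric]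
        uminus_q2_alg.abs_eq[symmetric] times_q2_alg.abs_eq[symmetric]
        scaleC_q2_alg.abs_eq[symmetric] adj_q2_alg.abs_eq[symmetric]\<close>)
  then show ?thesis by (metis Quotient3_abs_rep Quotient3_q2_alg)
qed

lemma cstar_seminorm_zero_fun: "cstar_seminorm (\<lambda>_. 0)"
  by (simp add: cstar_seminorm_def)

lemma q2_seminorms_bounded: "\<exists>M. \<forall>p. cstar_seminorm p \<longrightarrow> p (x::q2_alg) \<le> M"
proof (induction x rule: q2_alg_induct)
  case U then show ?case using cstar_seminorm_isometry alg_U_isometry by blast
next
  case S then show ?case using cstar_seminorm_isometry alg_S_isometry by blast
next
  case zero
  have "p 0 = 0" if "cstar_seminorm p" for p :: "q2_alg \<Rightarrow> real"
    using cstar_seminormD(3)[OF that, of 0 0] by simp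
  then show ?case by (metis order_refl)
next
  case one then show ?case using cstar_seminorm_one by blast
next
  case (add x y)
  then obtain M N where "\<forall>p. cstar_seminorm p \<longrightarrow> p x \<le> M" "\<forall>p. cstar_seminorm p \<longrightarrow> p y \<le> N" by blast
  then have "p (x + y) \<le> M + N" if "cstar_seminorm p" for p
    using cstar_seminormD(2)[OF that, of x y] that by (meson add_mono order_trans)
  then show ?case by blast
next
  case (minus x)
  have "p (- x) = p x" if "cstar_seminorm p" for p
    using cstar_seminormD(3)[OF that, of "-1" x] by (simp add: scaleC_minus_one)
  then show ?case using minus by metis
next
  case (mult x y)
  then obtain M N where MN: "\<forall>p. cstar_seminorm p \<longrightarrow> p x \<le> M" "\<forall>p. cstar_seminorm p \<longrightarrow> p y \<le> N"
    by blast
  have "p (x * y) \<le> M * N" if p: "cstar_seminorm p" for p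
    using cstar_seminormD(4)[OF p, of x y] MN p cstar_seminormD(1)[OF p]
    by (meson mult_mono order_trans)
  then show ?case by blast
next
  case (scale c x)
  then obtain M where "\<forall>p. cstar_seminorm p \<longrightarrow> p x \<le> M" by blast
  then show ?case using cstar_seminormD(3)
    by (intro exI[of _ "cmod c * M"]) (auto simp: cstar_seminormD(3) intro!: mult_left_mono)
next
  case (adj x) then show ?case using cstar_seminorm_adj by metis
qed

lemma q2_norm_upper: "cstar_seminorm p \<Longrightarrow> p x \<le> q2_norm x"
  unfolding q2_norm_def
  using q2_seminorms_bounded[of x] by (intro cSUP_upper) (auto simp: bdd_above_def)

lemma q2_norm_least: "(\<And>p. cstar_seminorm p \<Longrightarrow> p x \<le> M) \<Longrightarrow> q2_norm x \<le> M"
  unfolding q2_norm_def using cstar_seminorm_zero_fun by (intro cSUP_least) auto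

lemma cstar_seminorm_q2_norm: "cstar_seminorm q2_norm"
  unfolding cstar_seminorm_def
proof (intro conjI allI)
  fix x y c
  show nn: "0 \<le> q2_norm x" for x
    using q2_norm_upper[OF cstar_seminorm_zero_fun] by simp
  show "q2_norm (x + y) \<le> q2_norm x + q2_norm y"
    by (rule q2_norm_least) (meson add_mono cstar_seminormD(2) order_trans q2_norm_upper)
  show "q2_norm (x * y) \<le> q2_norm x * q2_norm y"
    by (rule q2_norm_least)
      (meson mult_mono cstar_seminormD(1,4) order_trans q2_norm_upper nn)
  have le: "q2_norm (d *\<^sub>C z) \<le> cmod d * q2_norm z" for d z
    by (rule q2_norm_least) (simp add: cstar_seminormD(3) mult_left_mono q2_norm_upper)
  show "q2_norm (c *\<^sub>C x) = cmod c * q2_norm x"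
  proof (cases "c = 0")
    case True
    then show ?thesis using le[of 0 x] nn[of 0] by simp
  next
    case False
    then have "q2_norm x \<le> cmod (inverse c) * q2_norm (c *\<^sub>C x)"
      using le[of "inverse c" "c *\<^sub>C x"] by (simp add: scaleC_scaleC scaleC_one)
    then have "cmod c * q2_norm x \<le> q2_norm (c *\<^sub>C x)"
      using False by (simp add: norm_inverse norm_divide field_simps)
    then show ?thesis using le[of c x] by simp
  qed
  show "q2_norm (adj x * x) = (q2_norm x)\<^sup>2"
  proof (rule antisym)
    show "q2_norm (adj x * x) \<le> (q2_norm x)\<^sup>2"
      by (rule q2_norm_least) (simp add: cstar_seminormD(1,5) q2_norm_upper power_mono)
    have "q2_norm x \<le> sqrt (q2_norm (adj x * x))"
    proof (rule q2_norm_least)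
      fix p :: "q2_alg \<Rightarrow> real" assume p: "cstar_seminorm p"
      then have "(p x)\<^sup>2 \<le> q2_norm (adj x * x)"
        using q2_norm_upper[OF p, of "adj x * x"] by (simp add: cstar_seminormD(5))
      then show "p x \<le> sqrt (q2_norm (adj x * x))" by (rule real_le_rsqrt)
    qed
    then show "(q2_norm x)\<^sup>2 \<le> q2_norm (adj x * x)"
      using power_mono[OF _ nn, of x _ 2] nn by fastforce
  qed
qed

lemmas q2_norm_simps = cstar_seminormD[OF cstar_seminorm_q2_norm]
lemmas q2_norm_adj = cstar_seminorm_adj[OF cstar_seminorm_q2_norm]

lemma q2_norm_zero [simp]: "q2_norm 0 = 0"
  using q2_norm_simps(3)[of 0 0] by simp

lemma q2_norm_minus: "q2_norm (- x) = q2_norm x"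
  using q2_norm_simps(3)[of "-1" x] by (simp add: scaleC_minus_one)

lemma q2_norm_minus_commute: "q2_norm (x - y) = q2_norm (y - x)"
  using q2_norm_minus[of "x - y"] by simp

lemma q2_norm_triangle3: "q2_norm (x - z) \<le> q2_norm (x - y) + q2_norm (y - z)"
  using q2_norm_simps(2)[of "x - y" "y - z"] by simp

lemma q2_norm_diff_abs: "\<bar>q2_norm x - q2_norm y\<bar> \<le> q2_norm (x - y)"
  using q2_norm_simps(2)[of "x - y" y] q2_norm_simps(2)[of "y - x" x]
  by (simp add: q2_norm_minus_commute)


section \<open>The 2-adic ring C*-algebra\<close>

lifting_forget q2_alg.lifting

definition q2_cauchy :: "(nat \<Rightarrow> q2_alg) \<Rightarrow> bool" where
  "q2_cauchy X \<longleftrightarrow> (\<forall>e>0. \<exists>N. \<forall>m\<ge>N. \<forall>n\<ge>N. q2_norm (X m - X n) < e)"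

definition q2_seq_eq :: "(nat \<Rightarrow> q2_alg) \<Rightarrow> (nat \<Rightarrow> q2_alg) \<Rightarrow> bool" where
  "q2_seq_eq X Y \<longleftrightarrow> q2_cauchy X \<and> q2_cauchy Y \<and> (\<lambda>n. q2_norm (X n - Y n)) \<longlonglongrightarrow> 0"

lemma q2_null_bound:
  assumes "f \<longlonglongrightarrow> 0" "g \<longlonglongrightarrow> 0" "\<And>n. q2_norm (Z n) \<le> K * (f n + g n)"
  shows "(\<lambda>n. q2_norm (Z n)) \<longlonglongrightarrow> 0"
proof (rule tendsto_sandwich[OF _ _ tendsto_const])
  show "(\<lambda>n. K * (f n + g n)) \<longlonglongrightarrow> 0"
    using tendsto_mult[OF tendsto_const[of K] tendsto_add[OF assms(1,2)]] by simp
qed (use assms(3) q2_norm_simps(1) in auto)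

lemma q2_cauchy_const [simp]: "q2_cauchy (\<lambda>_. a)"
  by (simp add: q2_cauchy_def)

lemma q2_seq_eq_refl: "q2_seq_eq X X \<longleftrightarrow> q2_cauchy X"
  by (simp add: q2_seq_eq_def)

lemma q2_cauchy_bound:
  assumes "q2_cauchy X" "q2_cauchy Y"
    "\<And>m n. q2_norm (Z m - Z n) \<le> K * (q2_norm (X m - X n) + q2_norm (Y m - Y n))"
  shows "q2_cauchy Z"
  unfolding q2_cauchy_def
proof (intro allI impI)
  fix e :: real assume e: "0 < e"
  define L where "L = \<bar>K\<bar> + 1"
  have L: "0 < L" "K \<le> L" by (auto simp: L_def)
  then have "0 < e / (2 * L)" using e by simp
  then obtain N1 N2 where
    N1: "\<forall>m\<ge>N1. \<forall>n\<ge>N1. q2_norm (X m - X n) < e / (2 * L)" and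
    N2: "\<forall>m\<ge>N2. \<forall>n\<ge>N2. q2_norm (Y m - Y n) < e / (2 * L)"
    using assms(1,2) unfolding q2_cauchy_def by blast
  have "q2_norm (Z m - Z n) < e" if "m \<ge> max N1 N2" "n \<ge> max N1 N2" for m n
  proof -
    have "q2_norm (X m - X n) + q2_norm (Y m - Y n) < e / L"
      using N1[rule_format, of m n] N2[rule_format, of m n] that by simp
    then have "L * (q2_norm (X m - X n) + q2_norm (Y m - Y n)) < e"
      using L(1) by (simp add: field_simps)
    moreover have "K * (q2_norm (X m - X n) + q2_norm (Y m - Y n))
        \<le> L * (q2_norm (X m - X n) + q2_norm (Y m - Y n))"
      using L(2) by (intro mult_right_mono) (auto simp: q2_norm_simps(1))
    ultimately show ?thesis using assms(3)[of m n] by linarith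
  qed
  then show "\<exists>N. \<forall>m\<ge>N. \<forall>n\<ge>N. q2_norm (Z m - Z n) < e" by blast
qed

lemma q2_cauchy_add: "q2_cauchy X \<Longrightarrow> q2_cauchy Y \<Longrightarrow> q2_cauchy (\<lambda>n. X n + Y n)"
  by (rule q2_cauchy_bound[where K = 1 and X = X and Y = Y])
    (use q2_norm_simps(2) in \<open>auto simp: add_diff_add\<close>)

lemma q2_cauchy_minus: "q2_cauchy X \<Longrightarrow> q2_cauchy (\<lambda>n. - X n)"
  by (rule q2_cauchy_bound[where K = 1 and X = X and Y = "\<lambda>_. 0"])
    (auto simp: q2_norm_minus_commute)

lemma q2_cauchy_diff: "q2_cauchy X \<Longrightarrow> q2_cauchy Y \<Longrightarrow> q2_cauchy (\<lambda>n. X n - Y n)"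
  using q2_cauchy_add[of X "\<lambda>n. - Y n"] q2_cauchy_minus[of Y] by simp

lemma q2_cauchy_scaleC: "q2_cauchy X \<Longrightarrow> q2_cauchy (\<lambda>n. c *\<^sub>C X n)"
  by (rule q2_cauchy_bound[where K = "cmod c" and X = X and Y = "\<lambda>_. 0"])
    (auto simp: q2_norm_simps(3) scaleC_diff_right[symmetric])

lemma q2_cauchy_adj: "q2_cauchy X \<Longrightarrow> q2_cauchy (\<lambda>n. adj (X n))"
  by (rule q2_cauchy_bound[where K = 1 and X = X and Y = "\<lambda>_. 0"])
    (auto simp: q2_norm_adj adj_diff[symmetric])

lemma q2_cauchy_norm:
  assumes "q2_cauchy X" shows "convergent (\<lambda>n. q2_norm (X n))"
proof -
  have "Cauchy (\<lambda>n. q2_norm (X n))"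
    using assms q2_norm_diff_abs unfolding q2_cauchy_def Cauchy_def dist_real_def
    by (meson le_less_trans)
  then show ?thesis by (rule Cauchy_convergent)
qed

lemma q2_cauchy_norm_lim: "q2_cauchy X \<Longrightarrow> (\<lambda>n. q2_norm (X n)) \<longlonglongrightarrow> lim (\<lambda>n. q2_norm (X n))"
  using q2_cauchy_norm convergent_LIMSEQ_iff by blast

lemma q2_cauchy_bounded:
  assumes "q2_cauchy X" obtains B where "\<And>n. q2_norm (X n) \<le> B"
  using convergent_imp_Bseq[OF q2_cauchy_norm[OF assms]]
  unfolding Bseq_def by (auto simp: q2_norm_simps(1))

lemma q2_norm_mult_diff:
  assumes "q2_norm a \<le> K" "q2_norm d \<le> K"
  shows "q2_norm (a * b - c * d) \<le> K * (q2_norm (a - c) + q2_norm (b - d))"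
proof -
  have "0 \<le> K" using assms(1) q2_norm_simps(1) order_trans by blast
  have "a * b - c * d = a * (b - d) + (a - c) * d" by (simp add: algebra_simps)
  then have "q2_norm (a * b - c * d) \<le> q2_norm a * q2_norm (b - d) + q2_norm (a - c) * q2_norm d"
    by (metis add_mono order_trans q2_norm_simps(2) q2_norm_simps(4))
  also have "\<dots> \<le> K * q2_norm (b - d) + q2_norm (a - c) * K"
    by (intro add_mono mult_mono) (use assms \<open>0 \<le> K\<close> in \<open>auto simp: q2_norm_simps(1)\<close>)
  finally show ?thesis by (simp add: algebra_simps)
qed

lemma q2_cauchy_mult:
  assumes "q2_cauchy X" "q2_cauchy Y" shows "q2_cauchy (\<lambda>n. X n * Y n)"
proof -
  obtain A B where "\<And>n. q2_norm (X n) \<le> A" "\<And>n. q2_norm (Y n) \<le> B"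
    using q2_cauchy_bounded assms by metis
  then have "q2_norm (X n) \<le> max A B" "q2_norm (Y n) \<le> max A B" for n
    by (meson max.cobounded1 max.cobounded2 order_trans)+
  then show ?thesis
    by (intro q2_cauchy_bound[OF assms, where K = "max A B"] q2_norm_mult_diff)
qed

lemmas q2_cauchy_intros = q2_cauchy_const q2_cauchy_add q2_cauchy_minus q2_cauchy_diff
  q2_cauchy_scaleC q2_cauchy_adj q2_cauchy_mult

lemma q2_seq_eq_sym: "q2_seq_eq X Y \<Longrightarrow> q2_seq_eq Y X"
  by (simp add: q2_seq_eq_def q2_norm_minus_commute)

lemma q2_seq_eq_trans:
  assumes "q2_seq_eq X Y" "q2_seq_eq Y Z" shows "q2_seq_eq X Z"
  using assms q2_norm_triangle3 unfolding q2_seq_eq_def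
  by (auto intro!: q2_null_bound[where K = 1 and f = "\<lambda>n. q2_norm (X n - Y n)"
        and g = "\<lambda>n. q2_norm (Y n - Z n)"])

lemma q2_seq_eq_add:
  assumes "q2_seq_eq X X'" "q2_seq_eq Y Y'"
  shows "q2_seq_eq (\<lambda>n. X n + Y n) (\<lambda>n. X' n + Y' n)"
  using assms q2_norm_simps(2) unfolding q2_seq_eq_def
  by (auto intro!: q2_cauchy_intros q2_null_bound[where K = 1 and f = "\<lambda>n. q2_norm (X n - X' n)"
        and g = "\<lambda>n. q2_norm (Y n - Y' n)"] simp: add_diff_add)

lemma q2_seq_eq_scaleC:
  assumes "q2_seq_eq X X'" shows "q2_seq_eq (\<lambda>n. c *\<^sub>C X n) (\<lambda>n. c *\<^sub>C X' n)"
  using assms tendsto_mult_right_zero[of "\<lambda>n. q2_norm (X n - X' n)" sequentially "cmod c"]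
  by (simp add: q2_seq_eq_def q2_cauchy_scaleC scaleC_diff_right[symmetric] q2_norm_simps(3))

lemma q2_seq_eq_minus:
  assumes "q2_seq_eq X X'" shows "q2_seq_eq (\<lambda>n. - X n) (\<lambda>n. - X' n)"
  using q2_seq_eq_scaleC[OF assms, of "-1"] by (simp add: scaleC_minus_one)

lemma q2_seq_eq_diff:
  assumes "q2_seq_eq X X'" "q2_seq_eq Y Y'"
  shows "q2_seq_eq (\<lambda>n. X n - Y n) (\<lambda>n. X' n - Y' n)"
  using q2_seq_eq_add[OF assms(1) q2_seq_eq_minus[OF assms(2)]] by simp

lemma q2_seq_eq_adj:
  assumes "q2_seq_eq X X'" shows "q2_seq_eq (\<lambda>n. adj (X n)) (\<lambda>n. adj (X' n))"
  using assms unfolding q2_seq_eq_def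
  by (auto intro!: q2_cauchy_intros simp: adj_diff[symmetric] q2_norm_adj)

lemma q2_seq_eq_mult:
  assumes "q2_seq_eq X X'" "q2_seq_eq Y Y'"
  shows "q2_seq_eq (\<lambda>n. X n * Y n) (\<lambda>n. X' n * Y' n)"
proof -
  have c: "q2_cauchy X" "q2_cauchy X'" "q2_cauchy Y" "q2_cauchy Y'"
    using assms by (auto simp: q2_seq_eq_def)
  obtain A B where "\<And>n. q2_norm (X n) \<le> A" "\<And>n. q2_norm (Y' n) \<le> B"
    using q2_cauchy_bounded c by metis
  then have "q2_norm (X n) \<le> max A B" "q2_norm (Y' n) \<le> max A B" for n
    by (meson max.cobounded1 max.cobounded2 order_trans)+
  then have "q2_norm (X n * Y n - X' n * Y' n)
      \<le> max A B * (q2_norm (X n - X' n) + q2_norm (Y n - Y' n))" for n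
    by (intro q2_norm_mult_diff)
  note le = this
  have "(\<lambda>n. q2_norm (X n * Y n - X' n * Y' n)) \<longlonglongrightarrow> 0"
    by (rule q2_null_bound[where K = "max A B" and f = "\<lambda>n. q2_norm (X n - X' n)"
          and g = "\<lambda>n. q2_norm (Y n - Y' n)" and Z = "\<lambda>n. X n * Y n - X' n * Y' n"])
      (use assms le in \<open>auto simp: q2_seq_eq_def\<close>)
  then show ?thesis using c by (simp add: q2_seq_eq_def q2_cauchy_mult)
qed

lemma q2_seq_eq_norm:
  assumes "q2_seq_eq X Y" shows "lim (\<lambda>n. q2_norm (X n)) = lim (\<lambda>n. q2_norm (Y n))"
proof -
  have X: "q2_cauchy X" and Y: "q2_cauchy Y" and *: "(\<lambda>n. q2_norm (X n - Y n)) \<longlonglongrightarrow> 0"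
    using assms by (auto simp: q2_seq_eq_def)
  have "(\<lambda>n. q2_norm (X n) - q2_norm (Y n)) \<longlonglongrightarrow> 0"
    by (rule Lim_null_comparison[OF _ *]) (simp add: q2_norm_diff_abs)
  moreover have "(\<lambda>n. q2_norm (X n) - q2_norm (Y n))
      \<longlonglongrightarrow> lim (\<lambda>n. q2_norm (X n)) - lim (\<lambda>n. q2_norm (Y n))"
    using X Y by (intro tendsto_diff q2_cauchy_norm_lim)
  ultimately show ?thesis using LIMSEQ_unique by fastforce
qed

quotient_type q2 = "nat \<Rightarrow> q2_alg" / partial: q2_seq_eq
proof (rule part_equivpI)
  show "\<exists>X. q2_seq_eq X X" using q2_cauchy_const q2_seq_eq_refl by blast
  show "symp q2_seq_eq" by (auto simp: symp_def intro: q2_seq_eq_sym)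
  show "transp q2_seq_eq" by (auto simp: transp_def intro: q2_seq_eq_trans)
qed

lift_definition q2_of :: "q2_alg \<Rightarrow> q2" is "\<lambda>a _. a"
  by (simp add: q2_seq_eq_refl)

instantiation q2 :: unital_star_algebra
begin
lift_definition zero_q2 :: q2 is "\<lambda>_. 0" by (simp add: q2_seq_eq_refl)
lift_definition one_q2 :: q2 is "\<lambda>_. 1" by (simp add: q2_seq_eq_refl)
lift_definition plus_q2 :: "q2 \<Rightarrow> q2 \<Rightarrow> q2" is "\<lambda>X Y n. X n + Y n" by (rule q2_seq_eq_add)
lift_definition uminus_q2 :: "q2 \<Rightarrow> q2" is "\<lambda>X n. - X n" by (rule q2_seq_eq_minus)
lift_definition minus_q2 :: "q2 \<Rightarrow> q2 \<Rightarrow> q2" is "\<lambda>X Y n. X n - Y n" by (rule q2_seq_eq_diff)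
lift_definition times_q2 :: "q2 \<Rightarrow> q2 \<Rightarrow> q2" is "\<lambda>X Y n. X n * Y n" by (rule q2_seq_eq_mult)
lift_definition scaleC_q2 :: "complex \<Rightarrow> q2 \<Rightarrow> q2" is "\<lambda>c X n. c *\<^sub>C X n" by (rule q2_seq_eq_scaleC)
lift_definition adj_q2 :: "q2 \<Rightarrow> q2" is "\<lambda>X n. adj (X n)" by (rule q2_seq_eq_adj)
instance
  by standard
    (transfer; simp add: q2_seq_eq_refl q2_cauchy_intros(2-) algebra_simps scaleC_add_right
      scaleC_add_left scaleC_scaleC scaleC_one mult_scaleC_left mult_scaleC_right
      adj_adj adj_add adj_mult adj_scaleC)+
end

instantiation q2 :: real_normed_algebra
begin
lift_definition norm_q2 :: "q2 \<Rightarrow> real" is "\<lambda>X. lim (\<lambda>n. q2_norm (X n))" by (rule q2_seq_eq_norm)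
definition scaleR_q2 :: "real \<Rightarrow> q2 \<Rightarrow> q2" where "scaleR_q2 r x = complex_of_real r *\<^sub>C x"
definition dist_q2 :: "q2 \<Rightarrow> q2 \<Rightarrow> real" where "dist_q2 x y = norm (x - y)"
definition sgn_q2 :: "q2 \<Rightarrow> q2" where "sgn_q2 x = inverse (norm x) *\<^sub>R x"
definition uniformity_q2 :: "(q2 \<times> q2) filter" where
  "uniformity_q2 = (INF e\<in>{0 <..}. principal {(x, y). dist x y < e})"
definition open_q2 :: "q2 set \<Rightarrow> bool" where
  "open_q2 U = (\<forall>x\<in>U. eventually (\<lambda>(x', y). x' = x \<longrightarrow> y \<in> U) uniformity)"

lemma norm_q2_limit:
  assumes "q2_cauchy X" shows "(\<lambda>n. q2_norm (X n)) \<longlonglongrightarrow> norm (abs_q2 X)"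
  using q2_cauchy_norm_lim[OF assms] by (simp add: norm_q2.abs_eq q2_seq_eq_refl assms)

lemma q2_rep: obtains X where "q2_cauchy X" "x = abs_q2 X"
  using Quotient3_q2 by (metis Quotient3_abs_rep Quotient3_rep_reflp q2_seq_eq_refl)

lemma q2_abs_eq_iff:
  "q2_cauchy X \<Longrightarrow> q2_cauchy Y \<Longrightarrow>
    abs_q2 X = abs_q2 Y \<longleftrightarrow> (\<lambda>n. q2_norm (X n - Y n)) \<longlonglongrightarrow> 0"
  using Quotient3_rel[OF Quotient3_q2, of X Y] by (auto simp: q2_seq_eq_def)

lemmas q2_abs_simps = plus_q2.abs_eq times_q2.abs_eq minus_q2.abs_eq uminus_q2.abs_eq
  scaleC_q2.abs_eq adj_q2.abs_eq q2_seq_eq_refl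

lemma norm_q2_scaleC: "norm (c *\<^sub>C (x::q2)) = cmod c * norm x"
proof -
  obtain X where X: "q2_cauchy X" "x = abs_q2 X" using q2_rep .
  have "(\<lambda>n. cmod c * q2_norm (X n)) \<longlonglongrightarrow> norm (c *\<^sub>C x)"
    using norm_q2_limit[OF q2_cauchy_scaleC[OF X(1), of c]] X
    by (simp add: q2_abs_simps q2_norm_simps(3))
  moreover have "(\<lambda>n. cmod c * q2_norm (X n)) \<longlonglongrightarrow> cmod c * norm x"
    using norm_q2_limit[OF X(1)] X(2) by (intro tendsto_intros) simp
  ultimately show ?thesis by (rule LIMSEQ_unique)
qed

lemma norm_q2_triangle: "norm (x + y) \<le> norm x + norm (y::q2)"
proof -
  obtain X where X: "q2_cauchy X" "x = abs_q2 X" using q2_rep .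
  obtain Y where Y: "q2_cauchy Y" "y = abs_q2 Y" using q2_rep .
  have "(\<lambda>n. q2_norm (X n + Y n)) \<longlonglongrightarrow> norm (x + y)"
    using norm_q2_limit[OF q2_cauchy_add[OF X(1) Y(1)]] X Y by (simp add: q2_abs_simps)
  moreover have "(\<lambda>n. q2_norm (X n) + q2_norm (Y n)) \<longlonglongrightarrow> norm x + norm y"
    using norm_q2_limit X Y by (intro tendsto_add) auto
  ultimately show ?thesis by (rule LIMSEQ_le) (auto simp: q2_norm_simps(2))
qed

lemma norm_q2_mult: "norm (x * y) \<le> norm x * norm (y::q2)"
proof -
  obtain X where X: "q2_cauchy X" "x = abs_q2 X" using q2_rep .
  obtain Y where Y: "q2_cauchy Y" "y = abs_q2 Y" using q2_rep .
  have "(\<lambda>n. q2_norm (X n * Y n)) \<longlonglongrightarrow> norm (x * y)"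
    using norm_q2_limit[OF q2_cauchy_mult[OF X(1) Y(1)]] X Y by (simp add: q2_abs_simps)
  moreover have "(\<lambda>n. q2_norm (X n) * q2_norm (Y n)) \<longlonglongrightarrow> norm x * norm y"
    using norm_q2_limit X Y by (intro tendsto_mult) auto
  ultimately show ?thesis by (rule LIMSEQ_le) (auto simp: q2_norm_simps(4))
qed

lemma norm_q2_cstar: "norm (adj x * x) = (norm (x::q2))\<^sup>2"
proof -
  obtain X where X: "q2_cauchy X" "x = abs_q2 X" using q2_rep .
  have "(\<lambda>n. (q2_norm (X n))\<^sup>2) \<longlonglongrightarrow> norm (adj x * x)"
    using norm_q2_limit[OF q2_cauchy_mult[OF q2_cauchy_adj[OF X(1)] X(1)]] X
    by (simp add: q2_abs_simps q2_cauchy_adj q2_norm_simps(5))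
  moreover have "(\<lambda>n. (q2_norm (X n))\<^sup>2) \<longlonglongrightarrow> (norm x)\<^sup>2"
    using norm_q2_limit[OF X(1)] X(2) by (intro tendsto_power) simp
  ultimately show ?thesis by (rule LIMSEQ_unique)
qed

lemma norm_q2_eq_zero: "norm (x::q2) = 0 \<longleftrightarrow> x = 0"
proof -
  obtain X where X: "q2_cauchy X" "x = abs_q2 X" using q2_rep .
  have "x = 0 \<longleftrightarrow> (\<lambda>n. q2_norm (X n)) \<longlonglongrightarrow> 0"
    using q2_abs_eq_iff[OF X(1) q2_cauchy_const[of 0]] X by (simp add: zero_q2_def)
  also have "\<dots> \<longleftrightarrow> norm x = 0"
    using norm_q2_limit[OF X(1)] X(2) LIMSEQ_unique by metis
  finally show ?thesis by simp
qed

instance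
proof
  fix a b :: real and c :: complex and x y z :: q2
  show "a *\<^sub>R (x + y) = a *\<^sub>R x + a *\<^sub>R y" by (simp add: scaleR_q2_def scaleC_add_right)
  show "(a + b) *\<^sub>R x = a *\<^sub>R x + b *\<^sub>R x" by (simp add: scaleR_q2_def scaleC_add_left)
  show "a *\<^sub>R b *\<^sub>R x = (a * b) *\<^sub>R x" by (simp add: scaleR_q2_def scaleC_scaleC)
  show "1 *\<^sub>R x = x" by (simp add: scaleR_q2_def scaleC_one)
  show "a *\<^sub>R x * y = a *\<^sub>R (x * y)" by (simp add: scaleR_q2_def mult_scaleC_left)
  show "x * a *\<^sub>R y = a *\<^sub>R (x * y)" by (simp add: scaleR_q2_def mult_scaleC_right)
  show "dist x y = norm (x - y)" by (rule dist_q2_def)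
  show "sgn x = inverse (norm x) *\<^sub>R x" by (rule sgn_q2_def)
  show "uniformity = (INF e\<in>{0 <..}. principal {(x, y::q2). dist x y < e})"
    by (rule uniformity_q2_def)
  show "open U = (\<forall>x\<in>U. \<forall>\<^sub>F (x', y) in uniformity. x' = x \<longrightarrow> y \<in> U)" for U :: "q2 set"
    by (rule open_q2_def)
  show "(norm x = 0) = (x = 0)" by (rule norm_q2_eq_zero)
  show "norm (x + y) \<le> norm x + norm y" by (rule norm_q2_triangle)
  show "norm (a *\<^sub>R x) = \<bar>a\<bar> * norm x" by (simp add: scaleR_q2_def norm_q2_scaleC)
  show "norm (x * y) \<le> norm x * norm y" by (rule norm_q2_mult)
qed
end

lemma dist_q2_of: "dist (q2_of a) (q2_of b) = q2_norm (a - b)"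
proof -
  have "q2_of a - q2_of b = abs_q2 (\<lambda>_. a - b)"
    by (simp add: q2_of_def q2_abs_simps)
  then show ?thesis by (simp add: dist_norm norm_q2.abs_eq q2_seq_eq_refl)
qed

lemma q2_of_tendsto:
  assumes X: "q2_cauchy X" shows "(\<lambda>k. q2_of (X k)) \<longlonglongrightarrow> abs_q2 X"
proof (rule metric_LIMSEQ_I)
  fix e :: real assume "0 < e"
  then obtain N where N: "\<And>m n. m \<ge> N \<Longrightarrow> n \<ge> N \<Longrightarrow> q2_norm (X m - X n) < e / 2"
    using X unfolding q2_cauchy_def by (meson half_gt_zero)
  have "dist (q2_of (X k)) (abs_q2 X) < e" if k: "k \<ge> N" for k
  proof -
    have "q2_of (X k) - abs_q2 X = abs_q2 (\<lambda>n. X k - X n)"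
      using X by (simp add: q2_of_def q2_abs_simps)
    moreover have "(\<lambda>n. q2_norm (X k - X n)) \<longlonglongrightarrow> norm (abs_q2 (\<lambda>n. X k - X n))"
      by (intro norm_q2_limit q2_cauchy_diff q2_cauchy_const X)
    ultimately have "(\<lambda>n. q2_norm (X k - X n)) \<longlonglongrightarrow> dist (q2_of (X k)) (abs_q2 X)"
      by (simp add: dist_norm)
    then have "dist (q2_of (X k)) (abs_q2 X) \<le> e / 2"
      by (rule LIMSEQ_le_const2) (metis N k less_imp_le)
    then show ?thesis using \<open>0 < e\<close> by simp
  qed
  then show "\<exists>N. \<forall>k\<ge>N. dist (q2_of (X k)) (abs_q2 X) < e" by blast
qed

instance q2 :: unital_cstar_algebra
proof
  fix c :: complex and r :: real and x :: q2
  show "r *\<^sub>R x = complex_of_real r *\<^sub>C x" by (rule scaleR_q2_def)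
  show "norm (c *\<^sub>C x) = cmod c * norm x" by (rule norm_q2_scaleC)
  show "norm (adj x * x) = (norm x)\<^sup>2" by (rule norm_q2_cstar)
next
  fix F :: "nat \<Rightarrow> q2" assume "Cauchy F"
  then have F: "\<exists>N. \<forall>m\<ge>N. \<forall>n\<ge>N. dist (F m) (F n) < e" if "0 < e" for e
    using that unfolding Cauchy_def by blast
  have "\<exists>a. dist (q2_of a) (F n) < inverse (real (Suc n))" for n
  proof -
    obtain X where X: "q2_cauchy X" "F n = abs_q2 X" using q2_rep .
    have "\<exists>k. dist (q2_of (X k)) (F n) < inverse (real (Suc n))"
      using metric_LIMSEQ_D[OF q2_of_tendsto[OF X(1)], of "inverse (real (Suc n))"] X(2) by auto
    then show ?thesis by blast
  qed
  then obtain A where A: "\<And>n. dist (q2_of (A n)) (F n) < inverse (real (Suc n))" by metis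
  have "q2_cauchy A"
    unfolding q2_cauchy_def
  proof (intro allI impI)
    fix e :: real assume e: "0 < e"
    obtain N1 where N1: "\<forall>m\<ge>N1. \<forall>n\<ge>N1. dist (F m) (F n) < e / 3" using F[of "e / 3"] e by auto
    obtain N2 where N2: "inverse (real (Suc N2)) < e / 3" using reals_Archimedean[of "e / 3"] e by auto
    have "q2_norm (A m - A n) < e" if mn: "m \<ge> max N1 N2" "n \<ge> max N1 N2" for m n
    proof -
      have near: "dist (q2_of (A k)) (F k) < e / 3" if "k \<ge> N2" for k
      proof -
        have "inverse (real (Suc k)) \<le> inverse (real (Suc N2))" using that by (intro le_imp_inverse_le) auto
        then show ?thesis using A[of k] N2 by linarith
      qed
      have "dist (F m) (F n) < e / 3" using N1 mn by simp
      then show ?thesis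
        using near[of m] near[of n] mn dist_triangle[of "q2_of (A m)" "q2_of (A n)" "F m"]
          dist_triangle[of "F m" "q2_of (A n)" "F n"] dist_commute[of "F n" "q2_of (A n)"]
        by (simp add: dist_q2_of)
    qed
    then show "\<exists>N. \<forall>m\<ge>N. \<forall>n\<ge>N. q2_norm (A m - A n) < e" by blast
  qed
  have "(\<lambda>n. dist (q2_of (A n)) (F n)) \<longlonglongrightarrow> 0"
    by (rule tendsto_sandwich[OF _ _ tendsto_const LIMSEQ_inverse_real_of_nat])
      (use less_imp_le[OF A] in auto)
  then have "F \<longlonglongrightarrow> abs_q2 A"
    using Lim_transform[OF q2_of_tendsto[OF \<open>q2_cauchy A\<close>], of F]
    by (simp add: dist_norm tendsto_norm_zero_iff norm_minus_commute)
  then show "convergent F" by (rule convergentI)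
qed

text \<open>\<open>q2\<close> is the universal unital C*-algebra of the relations by \<open>q2_generators_relations\<close>,
  \<open>q2_universal\<close> and \<open>q2_universal_unique\<close> below.\<close>

definition q2_U :: q2 where "q2_U = q2_of alg_U"
definition q2_S2 :: q2 where "q2_S2 = q2_of alg_S"
definition q2_S1 :: q2 where "q2_S1 = q2_U * q2_S2"

definition q2_relations :: "'a::unital_star_algebra \<Rightarrow> 'a \<Rightarrow> bool" where
  "q2_relations u s \<longleftrightarrow>
     adj u * u = 1 \<and> u * adj u = 1 \<and> adj s * s = 1 \<and>
     s * u = u\<^sup>2 * s \<and> s * adj s + u * s * adj s * adj u = 1"

definition cuntz_O2 :: "q2 set" where
  "cuntz_O2 = cstar_generated {q2_S1, q2_S2}"

section \<open>The universal property\<close>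

lemma q2_of_hom: "unital_star_hom q2_of"
  by (simp add: unital_star_hom_def q2_of_def q2_abs_simps one_q2_def)

lemma unital_star_homD:
  assumes "unital_star_hom f"
  shows "f 1 = 1" "f (x + y) = f x + f y" "f (x * y) = f x * f y" "f (c *\<^sub>C x) = c *\<^sub>C f x"
    "f (adj x) = adj (f x)" "f 0 = 0" "f (- x) = - f x" "f (x - y) = f x - f y"
proof -
  show *: "f 1 = 1" "f (x + y) = f x + f y" "f (x * y) = f x * f y" "f (c *\<^sub>C x) = c *\<^sub>C f x"
    "f (adj x) = adj (f x)" for x y c
    using assms by (auto simp: unital_star_hom_def)
  show m: "f (- x) = - f x" for x using *(4)[of "-1" x] by (simp add: scaleC_minus_one)
  show "f 0 = 0" using *(2)[of 0 0] by simp
  show "f (x - y) = f x - f y" using *(2)[of x "- y"] m by simp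
qed

lemma q2_generators_relations: "q2_relations q2_U q2_S2"
  unfolding q2_relations_def q2_U_def q2_S2_def power2_eq_square
  by (simp flip: unital_star_homD[OF q2_of_hom]
      add: alg_U_isometry alg_U_coisometry alg_S_isometry alg_commutation alg_ranges)

primrec q2_eval :: "'a::unital_star_algebra \<Rightarrow> 'a \<Rightarrow> q2_term \<Rightarrow> 'a" where
  "q2_eval u s TU = u"
| "q2_eval u s TS = s"
| "q2_eval u s TZero = 0"
| "q2_eval u s TOne = 1"
| "q2_eval u s (TAdd a b) = q2_eval u s a + q2_eval u s b"
| "q2_eval u s (TNeg a) = - q2_eval u s a"
| "q2_eval u s (TMul a b) = q2_eval u s a * q2_eval u s b"
| "q2_eval u s (TScale c a) = c *\<^sub>C q2_eval u s a"
| "q2_eval u s (TAdj a) = adj (q2_eval u s a)"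

lemma q2_eval_cong:
  assumes "q2_relations u s" "q2_eq a b" shows "q2_eval u s a = q2_eval u s b"
  using assms(2)
proof induction
  case (q2_sym a b) then show ?case by simp
next
  case (q2_trans a b c) then show ?case by simp
next
  case q2_ranges then show ?case using assms(1) by (simp add: q2_relations_def)
next
  case q2_commutation then show ?case using assms(1) by (simp add: q2_relations_def power2_eq_square)
next
  case q2_U_isometry then show ?case using assms(1) by (simp add: q2_relations_def)
next
  case q2_U_coisometry then show ?case using assms(1) by (simp add: q2_relations_def)
next
  case q2_S_isometry then show ?case using assms(1) by (simp add: q2_relations_def)
qed (simp_all add: algebra_simps scaleC_add_right scaleC_add_left scaleC_scaleC scaleC_one
    mult_scaleC_left mult_scaleC_right adj_adj adj_add adj_mult adj_scaleC)

lemma q2_alg_universal: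
  fixes u s :: "'b::unital_cstar_algebra"
  assumes rel: "q2_relations u s"
  obtains g where "unital_star_hom g" "g alg_U = u" "g alg_S = s" "\<And>x. norm (g x) \<le> q2_norm x"
proof -
  define g where "g x = q2_eval u s (rep_q2_alg x)" for x
  have g: "g (abs_q2_alg t) = q2_eval u s t" for t
    unfolding g_def by (rule q2_eval_cong[OF rel])
      (metis Quotient3_q2_alg rep_abs_rsp q2_refl q2_sym)
  have rep: "\<exists>t. x = abs_q2_alg t" for x by (metis Quotient3_abs_rep Quotient3_q2_alg)
  have hom: "unital_star_hom g"
    unfolding unital_star_hom_def
  proof (intro conjI allI)
    fix x y c
    obtain a b where [simp]: "x = abs_q2_alg a" "y = abs_q2_alg b" using rep by metis
    show "g 1 = 1" by (simp add: one_q2_alg_def g)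
    show "g (x + y) = g x + g y" by (simp add: plus_q2_alg.abs_eq g)
    show "g (x * y) = g x * g y" by (simp add: times_q2_alg.abs_eq g)
    show "g (c *\<^sub>C x) = c *\<^sub>C g x" by (simp add: scaleC_q2_alg.abs_eq g)
    show "g (adj x) = adj (g x)" by (simp add: adj_q2_alg.abs_eq g)
  qed
  have "cstar_seminorm (\<lambda>x. norm (g x))"
    by (simp add: cstar_seminorm_def unital_star_homD[OF hom] norm_triangle_ineq norm_scaleC
        norm_mult_ineq cstar_identity)
  then have "norm (g x) \<le> q2_norm x" for x by (rule q2_norm_upper)
  then show thesis using that[OF hom] by (simp add: alg_U_def alg_S_def g)
qed

theorem q2_universal:
  fixes u s :: "'b::unital_cstar_algebra"
  assumes rel: "q2_relations u s"
  shows "\<exists>f. unital_star_hom f \<and> (\<forall>x. norm (f x) \<le> norm x) \<and> f q2_U = u \<and> f q2_S2 = s"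
proof -
  obtain g where g: "unital_star_hom g" "g alg_U = u" "g alg_S = s" "\<And>x. norm (g x) \<le> q2_norm x"
    using q2_alg_universal[OF rel] by metis
  note hom = unital_star_homD[OF g(1)]
  define f where "f x = lim (\<lambda>n. g (rep_q2 x n))" for x
  have conv: "convergent (\<lambda>n. g (X n))" if "q2_cauchy X" for X
  proof -
    have "dist (g (X m)) (g (X n)) \<le> q2_norm (X m - X n)" for m n
      using g(4)[of "X m - X n"] by (simp add: dist_norm hom)
    then have "Cauchy (\<lambda>n. g (X n))"
      using that unfolding q2_cauchy_def Cauchy_def by (meson le_less_trans)
    then show ?thesis by (rule Cauchy_convergent)
  qed
  have f: "(\<lambda>n. g (X n)) \<longlonglongrightarrow> f (abs_q2 X)" if X: "q2_cauchy X" for X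
  proof -
    define Y where "Y = rep_q2 (abs_q2 X)"
    have eq: "q2_seq_eq Y X"
      unfolding Y_def using X by (metis Quotient3_q2 q2_seq_eq_refl rep_abs_rsp_left)
    then have null: "(\<lambda>n. q2_norm (Y n - X n)) \<longlonglongrightarrow> 0" and Y: "q2_cauchy Y"
      by (auto simp: q2_seq_eq_def)
    have "(\<lambda>n. g (Y n) - g (X n)) \<longlonglongrightarrow> 0"
      by (rule Lim_null_comparison[OF always_eventually null]) (simp add: g(4) flip: hom(8))
    moreover have "(\<lambda>n. g (Y n)) \<longlonglongrightarrow> f (abs_q2 X)"
      using conv[OF Y] by (simp add: f_def Y_def convergent_LIMSEQ_iff)
    ultimately show ?thesis by (rule Lim_transform2[rotated])
  qed
  have f_of: "f (q2_of a) = g a" for a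
    using f[of "\<lambda>_. a"] unfolding q2_of_def by (simp add: LIMSEQ_const_iff)
  have bound: "norm (f x) \<le> norm x" for x
  proof -
    obtain X where X: "q2_cauchy X" "x = abs_q2 X" using q2_rep .
    show ?thesis
      using LIMSEQ_le[OF tendsto_norm[OF f[OF X(1)]] norm_q2_limit[OF X(1)]] g(4) X(2) by blast
  qed
  have add: "f (x + y) = f x + f y" and mult: "f (x * y) = f x * f y"
    and scale: "f (c *\<^sub>C x) = c *\<^sub>C f x" and adj: "f (adj x) = adj (f x)" for x y c
  proof -
    obtain X where X: "q2_cauchy X" "x = abs_q2 X" using q2_rep .
    obtain Y where Y: "q2_cauchy Y" "y = abs_q2 Y" using q2_rep .
    note fX = f[OF X(1), folded X(2)] and fY = f[OF Y(1), folded Y(2)]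
    show "f (x + y) = f x + f y"
      using LIMSEQ_unique[OF f[OF q2_cauchy_add[OF X(1) Y(1)], unfolded hom] tendsto_add[OF fX fY]] X Y
      by (simp add: q2_abs_simps)
    show "f (x * y) = f x * f y"
      using LIMSEQ_unique[OF f[OF q2_cauchy_mult[OF X(1) Y(1)], unfolded hom] tendsto_mult[OF fX fY]] X Y
      by (simp add: q2_abs_simps)
    have null: "(\<lambda>n. norm (g (X n) - f x)) \<longlonglongrightarrow> 0"
      by (rule tendsto_norm_zero[OF LIM_zero[OF fX]])
    have "(\<lambda>n. c *\<^sub>C g (X n) - c *\<^sub>C f x) \<longlonglongrightarrow> 0"
      by (rule Lim_null_comparison[OF always_eventually tendsto_mult_right_zero[OF null, of "cmod c"]])
        (simp add: norm_scaleC flip: scaleC_diff_right)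
    then have fcX: "(\<lambda>n. c *\<^sub>C g (X n)) \<longlonglongrightarrow> c *\<^sub>C f x" by (rule LIM_zero_cancel)
    show "f (c *\<^sub>C x) = c *\<^sub>C f x"
      using LIMSEQ_unique[OF f[OF q2_cauchy_scaleC[OF X(1)], unfolded hom] fcX] X
      by (simp add: q2_abs_simps)
    have "(\<lambda>n. adj (g (X n)) - adj (f x)) \<longlonglongrightarrow> 0"
      by (rule Lim_null_comparison[OF always_eventually null])
        (simp add: norm_adj flip: adj_diff)
    then have faX: "(\<lambda>n. adj (g (X n))) \<longlonglongrightarrow> adj (f x)" by (rule LIM_zero_cancel)
    show "f (adj x) = adj (f x)"
      using LIMSEQ_unique[OF f[OF q2_cauchy_adj[OF X(1)], unfolded hom] faX] X
      by (simp add: q2_abs_simps)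
  qed
  have "f 1 = 1" using f_of[of 1] by (simp add: hom unital_star_homD[OF q2_of_hom])
  then have "unital_star_hom f" by (simp add: unital_star_hom_def add mult scale adj)
  then show ?thesis using bound f_of g(2,3) by (auto simp: q2_U_def q2_S2_def)
qed

text \<open>Every *-homomorphism between C*-algebras is contractive, hence continuous; this general fact
  is not proved here, and continuity is therefore a hypothesis below.\<close>

theorem q2_universal_unique:
  fixes f g :: "q2 \<Rightarrow> 'b::unital_cstar_algebra"
  assumes "unital_star_hom f" "continuous_on UNIV f" "unital_star_hom g" "continuous_on UNIV g"
    "f q2_U = g q2_U" "f q2_S2 = g q2_S2"
  shows "f = g"
proof
  fix x
  have of: "f (q2_of a) = g (q2_of a)" for a
    by (induction a rule: q2_alg_induct)
      (use assms(5,6) in \<open>simp_all add: q2_U_def q2_S2_def unital_star_homD[OF q2_of_hom]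
        unital_star_homD[OF assms(1)] unital_star_homD[OF assms(3)]\<close>)
  obtain X where X: "q2_cauchy X" "x = abs_q2 X" using q2_rep .
  have lim: "(\<lambda>k. q2_of (X k)) \<longlonglongrightarrow> x" using q2_of_tendsto X by simp
  have "(\<lambda>k. f (q2_of (X k))) \<longlonglongrightarrow> f x" "(\<lambda>k. g (q2_of (X k))) \<longlonglongrightarrow> g x"
    using continuous_on_tendsto_compose[OF assms(2) lim] continuous_on_tendsto_compose[OF assms(4) lim]
    by auto
  then show "f x = g x" using of LIMSEQ_unique by simp
qed

end

theory Submission
  imports Defs
begin

text \<open>
  Suppose \<open>E\<close> is a unital conditional expectation onto the Cuntz algebra and put \<open>T = E(U)\<close>. The
  generators satisfy \<open>U S\<^sub>2 = S\<^sub>1\<close> and \<open>U S\<^sub>1 = S\<^sub>2 U\<close>. Applying the bimodule map \<open>E\<close> gives the same two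
  equations for \<open>T\<close>, so that \<open>D = U - T\<close> satisfies \<open>D S\<^sub>2 = 0\<close> and \<open>D S\<^sub>1 = S\<^sub>2 D\<close>. It turns out that
  these equations force \<open>D = 0\<close> at the one place that matters, whereas \<open>U\<close> and elements of the
  Cuntz algebra differ there.

  The place is a matrix coefficient of the canonical representation on \<open>\<ell>\<^sup>2(\<int>)\<close>, where \<open>U e\<^sub>k = e\<^bsub>k+1\<^esub>\<close>,
  \<open>S\<^sub>2 e\<^sub>k = e\<^bsub>2k\<^esub>\<close> and \<open>S\<^sub>1 e\<^sub>k = e\<^bsub>2k+1\<^esub>\<close>. Both isometries preserve the sign of the index, so the Cuntz
  algebra has no coefficient from a negative to a nonnegative index (\<open>matrix_coeff_cuntz_O2\<close>), and
  \<open>\<langle>T e\<^bsub>-1\<^esub>, e\<^sub>0\<rangle> = 0\<close>. As \<open>\<langle>U e\<^bsub>-1\<^esub>, e\<^sub>0\<rangle> = 1\<close>, a contradiction follows once \<open>\<langle>D e\<^bsub>-1\<^esub>, e\<^sub>0\<rangle> = 0\<close>.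

  The equations for \<open>D\<close> give \<open>D e\<^sub>k = 0\<close> for all \<open>k \<ge> 0\<close> by induction (\<open>matrix_coeff_nonneg_eq_0\<close>),
  but leave \<open>D e\<^bsub>-1\<^esub>\<close> open, since \<open>-1\<close> is fixed by \<open>k \<mapsto> 2k + 1\<close>. To pass from the nonnegative indices
  to \<open>-1\<close>, consider the averages \<open>W\<^sub>n = n\<^sup>-\<^sup>1\<^sup>/\<^sup>2 \<Sum> U\<^bsup>2^i\<^esup>\<close> over \<open>n \<le> i < 2n\<close>. Translation by a high
  power of \<open>2\<close> is 2-adically small, and indeed the \<open>W\<^sub>n\<close> commute asymptotically with the *-algebra
  generated by \<open>U\<close> and \<open>S\<^sub>2\<close> and are eventually isometric on finitely supported sequences. Hence
  \<open>\<langle>X W\<^sub>n e\<^sub>k, W\<^sub>n e\<^sub>l\<rangle>\<close> tends to \<open>\<langle>X e\<^sub>k, e\<^sub>l\<rangle>\<close> for every \<open>X\<close> in the 2-adic ring C*-algebra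
  (\<open>matrix_coeff_average_limit\<close>). For \<open>X = D\<close> and \<open>k = -1\<close> the left-hand side is \<open>0\<close>, because
  \<open>W\<^sub>n e\<^bsub>-1\<^esub>\<close> is supported on nonnegative integers.
\<close>

section \<open>Finitely supported sequences as an inner product space\<close>

text \<open>The canonical representation acts on \<open>\<ell>\<^sup>2(\<int>)\<close>. Since \<open>U\<close>, \<open>S\<^sub>2\<close> and their adjoints map finitely
  supported sequences to finitely supported ones, the dense subspace of those carries everything
  needed below. The inner product is the real part of the usual one; adjoints of complex-linear
  operators with respect to both are the same.\<close>

typedef finseq = "{f :: int \<Rightarrow> complex. finite {k. f k \<noteq> 0}}"
  morphisms coeff Abs_finseq
  by (rule exI[of _ "\<lambda>_. 0"]) simp

setup_lifting type_definition_finseq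

lemma finseq_eqI: "(\<And>k. coeff x k = coeff y k) \<Longrightarrow> x = y"
  by (simp add: coeff_inject[symmetric] fun_eq_iff)

lemma finite_support: "finite {k. coeff x k \<noteq> 0}"
  using coeff by auto

instantiation finseq :: ab_group_add
begin
lift_definition zero_finseq :: finseq is "\<lambda>_. 0" by simp
lift_definition plus_finseq :: "finseq \<Rightarrow> finseq \<Rightarrow> finseq" is "\<lambda>f g k. f k + g k"
  subgoal for f g by (rule finite_subset[of _ "{k. f k \<noteq> 0} \<union> {k. g k \<noteq> 0}"]) auto
  done
lift_definition uminus_finseq :: "finseq \<Rightarrow> finseq" is "\<lambda>f k. - f k" by simp
lift_definition minus_finseq :: "finseq \<Rightarrow> finseq \<Rightarrow> finseq" is "\<lambda>f g k. f k - g k"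
  subgoal for f g by (rule finite_subset[of _ "{k. f k \<noteq> 0} \<union> {k. g k \<noteq> 0}"]) auto
  done
instance by standard (transfer; simp add: fun_eq_iff algebra_simps)+
end

lift_definition cscale :: "complex \<Rightarrow> finseq \<Rightarrow> finseq" is "\<lambda>c f k. c * f k"
  by (rule finite_subset[rotated]) auto

lemma coeff_simps [simp]:
  "coeff 0 k = 0" "coeff (x + y) k = coeff x k + coeff y k" "coeff (- x) k = - coeff x k"
  "coeff (x - y) k = coeff x k - coeff y k" "coeff (cscale c x) k = c * coeff x k"
  by (transfer; simp)+

instantiation finseq :: real_inner
begin

definition scaleR_finseq :: "real \<Rightarrow> finseq \<Rightarrow> finseq" where
  "scaleR_finseq r x = cscale (complex_of_real r) x"
definition inner_finseq :: "finseq \<Rightarrow> finseq \<Rightarrow> real" where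
  "inner_finseq x y = (\<Sum>k | coeff x k \<noteq> 0. coeff x k \<bullet> coeff y k)"
definition norm_finseq :: "finseq \<Rightarrow> real" where "norm_finseq x = sqrt (x \<bullet> x)"
definition dist_finseq :: "finseq \<Rightarrow> finseq \<Rightarrow> real" where "dist_finseq x y = norm (x - y)"
definition sgn_finseq :: "finseq \<Rightarrow> finseq" where "sgn_finseq x = inverse (norm x) *\<^sub>R x"
definition uniformity_finseq :: "(finseq \<times> finseq) filter" where
  "uniformity_finseq = (INF e\<in>{0 <..}. principal {(x, y). dist x y < e})"
definition open_finseq :: "finseq set \<Rightarrow> bool" where
  "open_finseq U = (\<forall>x\<in>U. eventually (\<lambda>(x', y). x' = x \<longrightarrow> y \<in> U) uniformity)"

lemma inner_finseq_superset:
  assumes "finite K" "\<And>k. k \<notin> K \<Longrightarrow> coeff x k = 0 \<or> coeff y k = 0"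
  shows "x \<bullet> y = (\<Sum>k\<in>K. coeff x k \<bullet> coeff y k)"
proof -
  have "x \<bullet> y = (\<Sum>k\<in>K \<union> {k. coeff x k \<noteq> 0}. coeff x k \<bullet> coeff y k)"
    unfolding inner_finseq_def
    by (rule sum.mono_neutral_left) (auto simp: assms(1) finite_support)
  also have "\<dots> = (\<Sum>k\<in>K. coeff x k \<bullet> coeff y k)"
    by (rule sum.mono_neutral_right) (use assms in \<open>fastforce simp: finite_support\<close>)+
  finally show ?thesis .
qed

instance
proof
  fix a b r :: real and x y z :: finseq
  show "a *\<^sub>R (x + y) = a *\<^sub>R x + a *\<^sub>R y" "(a + b) *\<^sub>R x = a *\<^sub>R x + b *\<^sub>R x"
    "a *\<^sub>R b *\<^sub>R x = (a * b) *\<^sub>R x" "1 *\<^sub>R x = x"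
    by (auto intro!: finseq_eqI simp: scaleR_finseq_def algebra_simps)
  show "dist x y = norm (x - y)" "sgn x = inverse (norm x) *\<^sub>R x" "norm x = sqrt (x \<bullet> x)"
    by (auto simp: dist_finseq_def sgn_finseq_def norm_finseq_def)
  show "uniformity = (INF e\<in>{0 <..}. principal {(x, y::finseq). dist x y < e})"
    by (rule uniformity_finseq_def)
  show "open U = (\<forall>x\<in>U. \<forall>\<^sub>F (x', y) in uniformity. x' = x \<longrightarrow> y \<in> U)" for U :: "finseq set"
    by (rule open_finseq_def)
  have sup: "v \<bullet> w = (\<Sum>k\<in>{k. coeff x k \<noteq> 0} \<union> {k. coeff y k \<noteq> 0} \<union> {k. coeff z k \<noteq> 0}.
      coeff v k \<bullet> coeff w k)"
    if "\<And>k. coeff x k = 0 \<Longrightarrow> coeff y k = 0 \<Longrightarrow> coeff z k = 0 \<Longrightarrow> coeff v k = 0" for v w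
    by (rule inner_finseq_superset) (use that in \<open>auto simp: finite_support\<close>)
  show "x \<bullet> y = y \<bullet> x" by (subst (1 2) sup) (auto simp: inner_commute)
  show "(x + y) \<bullet> z = x \<bullet> z + y \<bullet> z"
    by (subst (1 2 3) sup) (auto simp: inner_add_left sum.distrib)
  show "r *\<^sub>R x \<bullet> y = r * (x \<bullet> y)"
    by (subst (1 2) sup)
      (auto simp: scaleR_finseq_def scaleR_conv_of_real[symmetric] sum_distrib_left)
  show "0 \<le> x \<bullet> x" unfolding inner_finseq_def by (rule sum_nonneg) simp
  show "x \<bullet> x = 0 \<longleftrightarrow> x = 0"
  proof
    assume "x \<bullet> x = 0"
    then have "coeff x k = 0" for k
      unfolding inner_finseq_def by (subst (asm) sum_nonneg_eq_0_iff) (auto simp: finite_support)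
    then show "x = 0" by (intro finseq_eqI) simp
  qed (simp add: inner_finseq_def)
qed

end

lemma inner_cscale: "cscale c x \<bullet> y = x \<bullet> cscale (cnj c) y"
proof -
  have *: "v \<bullet> w = (\<Sum>k | coeff x k \<noteq> 0. coeff v k \<bullet> coeff w k)"
    if "\<And>k. coeff x k = 0 \<Longrightarrow> coeff v k = 0" for v w
    by (rule inner_finseq_superset) (use that in \<open>auto simp: finite_support\<close>)
  show ?thesis by (subst (1 2) *) (auto simp: inner_complex_def algebra_simps intro!: sum.cong)
qed

lemma cscale_add: "cscale c (x + y) = cscale c x + cscale c y"
  by (rule finseq_eqI) (simp add: algebra_simps)

lemma cscale_cscale: "cscale c (cscale d x) = cscale (c * d) x"
  by (rule finseq_eqI) (simp add: algebra_simps)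

lemma cscale_scaleR: "cscale c (r *\<^sub>R x) = r *\<^sub>R cscale c x"
  by (rule finseq_eqI) (simp add: scaleR_finseq_def)

lemma norm_cscale: "norm (cscale c x) = cmod c * norm x"
proof -
  have "cscale c x \<bullet> cscale c x = (cmod c)\<^sup>2 * (x \<bullet> x)"
  proof -
    have "cscale c x \<bullet> cscale c x = cscale (of_real ((cmod c)\<^sup>2)) x \<bullet> x"
      by (simp add: inner_cscale cscale_cscale complex_norm_square[symmetric] mult.commute)
    also have "\<dots> = (cmod c)\<^sup>2 * (x \<bullet> x)"
      unfolding scaleR_finseq_def[symmetric] by simp
    finally show ?thesis .
  qed
  then show ?thesis by (simp add: norm_eq_sqrt_inner real_sqrt_mult)
qed

lemma bounded_linear_cscale: "bounded_linear (cscale c)"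
  by (rule bounded_linear_intro[where K = "cmod c"])
    (simp_all add: cscale_add cscale_scaleR norm_cscale mult.commute)

lift_definition basis :: "int \<Rightarrow> finseq" is "\<lambda>k j. if j = k then 1 else 0" by simp

lemma coeff_basis: "coeff (basis k) j = (if j = k then 1 else 0)"
  by transfer simp

lemma inner_basis: "x \<bullet> basis k = Re (coeff x k)"
  by (subst inner_finseq_superset[of "{k}"]) (auto simp: coeff_basis)

lemma norm_basis: "norm (basis k) = 1"
  by (simp add: norm_eq_sqrt_inner inner_basis coeff_basis)

section \<open>Translation and dilation\<close>

lift_definition translate :: "int \<Rightarrow> finseq \<Rightarrow> finseq" is "\<lambda>m f k. f (k - m)"
  subgoal for m f
    using finite_vimageI[of "{k. f k \<noteq> 0}" "\<lambda>k. k - m"] by (simp add: vimage_def inj_def)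
  done

text \<open>\<open>dilate\<close> sends the basis vector at \<open>k\<close> to the one at \<open>2k\<close>; it represents \<open>S\<^sub>2\<close>, and \<open>contract\<close>
  is its adjoint.\<close>

lift_definition dilate :: "finseq \<Rightarrow> finseq" is "\<lambda>f k. if even k then f (k div 2) else 0"
  subgoal for f
    by (rule finite_subset[of _ "(\<lambda>j. 2 * j) ` {k. f k \<noteq> 0}"]) (auto split: if_splits)
  done

lift_definition contract :: "finseq \<Rightarrow> finseq" is "\<lambda>f k. f (2 * k)"
  subgoal for f
    using finite_vimageI[of "{k. f k \<noteq> 0}" "\<lambda>k. 2 * k"] by (simp add: vimage_def inj_def)
  done

lemma coeff_translate [simp]: "coeff (translate m x) k = coeff x (k - m)"
  and coeff_dilate [simp]: "coeff (dilate x) k = (if even k then coeff x (k div 2) else 0)"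
  and coeff_contract [simp]: "coeff (contract x) k = coeff x (2 * k)"
  by (transfer; simp)+

lemma inner_translate: "translate m x \<bullet> y = x \<bullet> translate (- m) y"
  unfolding inner_finseq_def
  by (rule sum.reindex_bij_witness[where i = "\<lambda>k. k + m" and j = "\<lambda>k. k - m"]) auto

lemma inner_dilate: "dilate x \<bullet> y = x \<bullet> contract y"
  unfolding inner_finseq_def
  by (rule sum.reindex_bij_witness[where i = "\<lambda>k. 2 * k" and j = "\<lambda>k. k div 2"])
    (auto split: if_splits)

lemma translate_translate: "translate m (translate n x) = translate (m + n) x"
  by (rule finseq_eqI) (simp add: algebra_simps)

lemma translate_zero [simp]: "translate 0 x = x"
  by (rule finseq_eqI) simp

lemma contract_dilate: "contract (dilate x) = x"
  by (rule finseq_eqI) simp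

lemma norm_translate: "norm (translate m x) = norm x"
  by (simp add: norm_eq_sqrt_inner inner_translate translate_translate)

lemma norm_dilate: "norm (dilate x) = norm x"
  by (simp add: norm_eq_sqrt_inner inner_dilate contract_dilate)

lemma norm_contract_le: "norm (contract x) \<le> norm x"
proof -
  have "norm (contract x) * norm (contract x) = dilate (contract x) \<bullet> x"
    by (simp add: inner_dilate power2_norm_eq_inner[symmetric] power2_eq_square)
  also have "\<dots> \<le> norm (contract x) * norm x"
    using norm_cauchy_schwarz[of "dilate (contract x)" x] by (simp add: norm_dilate)
  finally show ?thesis by (cases "norm (contract x) = 0") (auto simp: mult_le_cancel_left)
qed

lemma bounded_linear_translate: "bounded_linear (translate m)"
  by (rule bounded_linear_intro[where K = 1])
    (auto intro!: finseq_eqI simp: norm_translate scaleR_finseq_def)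

lemma bounded_linear_dilate: "bounded_linear dilate"
  by (rule bounded_linear_intro[where K = 1])
    (auto intro!: finseq_eqI simp: norm_dilate scaleR_finseq_def)

lemma bounded_linear_contract: "bounded_linear contract"
  by (rule bounded_linear_intro[where K = 1])
    (auto intro!: finseq_eqI simp: norm_contract_le scaleR_finseq_def)

lifting_forget finseq.lifting

section \<open>The *-algebra of adjointable operators\<close>

text \<open>An operator is stored together with its adjoint, which makes the involution a swap. Adjoints are
  unique (\<open>adjointable_eqI\<close>), so two such pairs are equal as soon as the operators are.\<close>

typedef adjointable = "{(A :: finseq \<Rightarrow> finseq, B :: finseq \<Rightarrow> finseq).
    bounded_linear A \<and> bounded_linear B \<and> (\<forall>x y. A x \<bullet> y = x \<bullet> B y) \<and>
    (\<forall>c x. A (cscale c x) = cscale c (A x)) \<and> (\<forall>c x. B (cscale c x) = cscale c (B x))}"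
  by (rule exI[of _ "(\<lambda>x. x, \<lambda>x. x)"]) simp

setup_lifting type_definition_adjointable

instantiation adjointable :: unital_star_algebra
begin
lift_definition zero_adjointable :: adjointable is "(\<lambda>_. 0, \<lambda>_. 0)"
  by (auto intro!: finseq_eqI)
lift_definition one_adjointable :: adjointable is "(\<lambda>x. x, \<lambda>x. x)" by simp
lift_definition plus_adjointable :: "adjointable \<Rightarrow> adjointable \<Rightarrow> adjointable"
  is "\<lambda>(A, B) (C, D). (\<lambda>x. A x + C x, \<lambda>x. B x + D x)"
  by (auto simp: bounded_linear_add inner_add_left inner_add_right cscale_add)
lift_definition uminus_adjointable :: "adjointable \<Rightarrow> adjointable"
  is "\<lambda>(A, B). (\<lambda>x. - A x, \<lambda>x. - B x)"
  by (auto simp: bounded_linear_minus intro!: finseq_eqI)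
lift_definition minus_adjointable :: "adjointable \<Rightarrow> adjointable \<Rightarrow> adjointable"
  is "\<lambda>(A, B) (C, D). (\<lambda>x. A x - C x, \<lambda>x. B x - D x)"
  by (auto simp: bounded_linear_sub inner_diff_left inner_diff_right algebra_simps intro!: finseq_eqI)
lift_definition times_adjointable :: "adjointable \<Rightarrow> adjointable \<Rightarrow> adjointable"
  is "\<lambda>(A, B) (C, D). (\<lambda>x. A (C x), \<lambda>x. D (B x))"
  by (auto intro: bounded_linear_compose)
lift_definition scaleC_adjointable :: "complex \<Rightarrow> adjointable \<Rightarrow> adjointable"
  is "\<lambda>c (A, B). (\<lambda>x. cscale c (A x), \<lambda>x. cscale (cnj c) (B x))"
  by (auto simp: inner_cscale cscale_cscale mult.commute
      intro: bounded_linear_compose[OF bounded_linear_cscale])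
lift_definition adj_adjointable :: "adjointable \<Rightarrow> adjointable" is "\<lambda>(A, B). (B, A)"
  by (auto simp: inner_commute)
instance
  by standard
    (transfer; auto simp: fun_eq_iff linear_simps cscale_add cscale_cscale mult.commute
      intro!: finseq_eqI; simp add: algebra_simps)+
end

lift_definition app :: "adjointable \<Rightarrow> finseq \<Rightarrow> finseq" is fst .

lemma app_simps [simp]:
  "app 0 x = 0" "app 1 x = x" "app (S + T) x = app S x + app T x" "app (- T) x = - app T x"
  "app (S - T) x = app S x - app T x" "app (S * T) x = app S (app T x)"
  "app (c *\<^sub>C T) x = cscale c (app T x)"
  by (transfer; auto)+

lemma bounded_linear_app: "bounded_linear (app T)"
  by transfer auto

lemma inner_app: "app T x \<bullet> y = x \<bullet> app (adj T) y"
  by transfer auto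

lemma adjointable_eqI:
  assumes "\<And>x. app S x = app T x" shows "S = T"
proof -
  have "app (adj S) y = app (adj T) y" for y
    by (metis assms inner_app vector_eq_rdot inner_commute)
  with assms show ?thesis by transfer (auto simp: fun_eq_iff)
qed

lemma norm_app_le: "norm (app T x) \<le> onorm (app T) * norm x"
  by (rule onorm[OF bounded_linear_app])

text \<open>With \<open>z = T*y\<close>, Cauchy--Schwarz gives \<open>\<parallel>z\<parallel>\<^sup>2 = \<langle>Tz, y\<rangle> \<le> \<parallel>T\<parallel> \<parallel>z\<parallel> \<parallel>y\<parallel>\<close>, and one factor \<open>\<parallel>z\<parallel>\<close> cancels.\<close>

lemma onorm_adj_le: "onorm (app (adj T)) \<le> onorm (app T)"
proof (rule onorm_bound)
  fix y
  let ?z = "app (adj T) y"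
  have "norm ?z * norm ?z = app T ?z \<bullet> y"
    by (simp add: inner_app power2_norm_eq_inner[symmetric] power2_eq_square)
  also have "\<dots> \<le> norm (app T ?z) * norm y"
    by (rule norm_cauchy_schwarz)
  also have "\<dots> \<le> (onorm (app T) * norm y) * norm ?z"
    using mult_right_mono[OF norm_app_le[of T ?z], of "norm y"] by (simp add: mult_ac)
  finally show "norm ?z \<le> onorm (app T) * norm y"
    by (cases "norm ?z = 0") (auto simp: onorm_pos_le[OF bounded_linear_app] mult_le_cancel_right)
qed (rule onorm_pos_le[OF bounded_linear_app])

text \<open>The C*-identity holds without completeness: \<open>\<parallel>Tx\<parallel>\<^sup>2 = \<langle>x, T*Tx\<rangle> \<le> \<parallel>T*T\<parallel> \<parallel>x\<parallel>\<^sup>2\<close>. Consequently the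
  universal norm dominates the operator norm of every representation on finitely supported
  sequences, see \<open>norm_act_le\<close>.\<close>

lemma cstar_seminorm_onorm: "cstar_seminorm (\<lambda>T. onorm (app T))"
  unfolding cstar_seminorm_def
proof (intro conjI allI)
  fix S T c
  have pos: "0 \<le> onorm (app R)" for R by (rule onorm_pos_le[OF bounded_linear_app])
  have comp: "onorm (app (R * R')) \<le> onorm (app R) * onorm (app R')" for R R'
    using onorm_compose[OF bounded_linear_app bounded_linear_app, of R R']
    by (simp add: comp_def flip: app_simps(6))
  show "0 \<le> onorm (app S)" by (rule pos)
  show "onorm (app (S + T)) \<le> onorm (app S) + onorm (app T)"
    using onorm_triangle[OF bounded_linear_app bounded_linear_app, of S T]
    by (simp flip: app_simps(3))
  show "onorm (app (S * T)) \<le> onorm (app S) * onorm (app T)" by (rule comp)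
  have "onorm (app (c *\<^sub>C T)) = onorm (\<lambda>x. cmod c *\<^sub>R app T x)"
    unfolding onorm_def by (simp add: norm_cscale)
  then show "onorm (app (c *\<^sub>C T)) = cmod c * onorm (app T)"
    by (simp add: onorm_scaleR[OF bounded_linear_app])
  show "onorm (app (adj T * T)) = (onorm (app T))\<^sup>2"
  proof (rule antisym)
    show "onorm (app (adj T * T)) \<le> (onorm (app T))\<^sup>2"
      using comp[of "adj T" T] mult_right_mono[OF onorm_adj_le pos, of T T]
      by (simp add: power2_eq_square)
    have "onorm (app T) \<le> sqrt (onorm (app (adj T * T)))"
    proof (rule onorm_bound)
      fix x
      have "(norm (app T x))\<^sup>2 = x \<bullet> app (adj T * T) x"
        by (simp add: power2_norm_eq_inner inner_app)
      also have "\<dots> \<le> norm x * (onorm (app (adj T * T)) * norm x)"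
        by (rule order_trans[OF norm_cauchy_schwarz mult_left_mono[OF norm_app_le]]) simp
      finally have "(norm (app T x))\<^sup>2 \<le> onorm (app (adj T * T)) * (norm x)\<^sup>2"
        by (simp add: power2_eq_square mult_ac)
      then show "norm (app T x) \<le> sqrt (onorm (app (adj T * T))) * norm x"
        by (metis norm_ge_zero real_le_rsqrt real_sqrt_mult real_sqrt_power real_sqrt_pow2
            real_sqrt_abs abs_norm_cancel)
    qed (simp add: pos del: app_simps)
    then show "(onorm (app T))\<^sup>2 \<le> onorm (app (adj T * T))"
      using power_mono[OF _ pos, of T _ 2] pos[of "adj T * T"] by fastforce
  qed
qed

section \<open>The representation on the integers\<close>

lift_definition U_op :: adjointable is "(translate 1, translate (- 1))"
  by (auto simp: bounded_linear_translate inner_translate intro!: finseq_eqI)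

lift_definition S_op :: adjointable is "(dilate, contract)"
  by (auto simp: bounded_linear_dilate bounded_linear_contract inner_dilate intro!: finseq_eqI)

lemma app_U_S [simp]:
  "app U_op = translate 1" "app (adj U_op) = translate (- 1)"
  "app S_op = dilate" "app (adj S_op) = contract"
  by (transfer; simp)+

lemma q2_relations_U_S_op: "q2_relations U_op S_op"
  unfolding q2_relations_def
  by (intro conjI adjointable_eqI finseq_eqI) (auto simp: power2_eq_square)

definition rep :: "q2_alg \<Rightarrow> adjointable" where
  "rep a = q2_eval U_op S_op (rep_q2_alg a)"

lemma rep_abs: "rep (abs_q2_alg t) = q2_eval U_op S_op t"
  unfolding rep_def
  by (rule q2_eval_cong[OF q2_relations_U_S_op])
    (metis Quotient3_q2_alg rep_abs_rsp q2_refl q2_sym)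

lemma unital_star_hom_rep: "unital_star_hom rep"
  unfolding unital_star_hom_def
proof (intro conjI allI)
  fix x y c
  obtain a b where [simp]: "x = abs_q2_alg a" "y = abs_q2_alg b"
    by (metis Quotient3_abs_rep Quotient3_q2_alg)
  show "rep 1 = 1" by (simp add: one_q2_alg_def rep_abs)
  show "rep (x + y) = rep x + rep y" by (simp add: plus_q2_alg.abs_eq rep_abs)
  show "rep (x * y) = rep x * rep y" by (simp add: times_q2_alg.abs_eq rep_abs)
  show "rep (c *\<^sub>C x) = c *\<^sub>C rep x" by (simp add: scaleC_q2_alg.abs_eq rep_abs)
  show "rep (adj x) = adj (rep x)" by (simp add: adj_q2_alg.abs_eq rep_abs)
qed

lemma rep_generators: "rep alg_U = U_op" "rep alg_S = S_op"
  by (simp_all add: alg_U_def alg_S_def rep_abs)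

definition act :: "q2_alg \<Rightarrow> finseq \<Rightarrow> finseq" where "act a = app (rep a)"

lemma act_simps [simp]:
  "act 0 x = 0" "act 1 x = x" "act (a + b) x = act a x + act b x" "act (- a) x = - act a x"
  "act (a - b) x = act a x - act b x" "act (a * b) x = act a (act b x)"
  "act (c *\<^sub>C a) x = cscale c (act a x)"
  by (simp_all add: act_def unital_star_homD[OF unital_star_hom_rep])

lemma act_generators [simp]:
  "act alg_U = translate 1" "act (adj alg_U) = translate (- 1)"
  "act alg_S = dilate" "act (adj alg_S) = contract"
  by (simp_all add: act_def unital_star_homD[OF unital_star_hom_rep] rep_generators)

lemma inner_act: "act a x \<bullet> y = x \<bullet> act (adj a) y"
  by (simp add: act_def unital_star_homD[OF unital_star_hom_rep] inner_app)

lemma bounded_linear_act: "bounded_linear (act a)"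
  unfolding act_def by (rule bounded_linear_app)

lemma norm_act_le: "norm (act a x) \<le> q2_norm a * norm x"
proof -
  have "cstar_seminorm (\<lambda>a. onorm (app (rep a)))"
    using cstar_seminormD[OF cstar_seminorm_onorm]
    by (simp add: cstar_seminorm_def unital_star_homD[OF unital_star_hom_rep] del: app_simps)
  then have "onorm (app (rep a)) \<le> q2_norm a" by (rule q2_norm_upper)
  then show ?thesis
    unfolding act_def by (meson norm_app_le mult_right_mono norm_ge_zero order_trans)
qed

section \<open>Matrix coefficients\<close>

text \<open>The universal C*-algebra is a completion and need not map finitely supported sequences to
  finitely supported ones. Only the functionals \<open>a \<mapsto> \<langle>ax, y\<rangle>\<close> are extended to it, by continuity; every
  estimate then stays on finitely supported sequences.\<close>

definition matrix_coeff :: "finseq \<Rightarrow> finseq \<Rightarrow> q2 \<Rightarrow> real" where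
  "matrix_coeff x y T = lim (\<lambda>n. act (rep_q2 T n) x \<bullet> y)"

lemma inner_act_le: "\<bar>act a x \<bullet> y\<bar> \<le> q2_norm a * (norm x * norm y)"
proof -
  have "\<bar>act a x \<bullet> y\<bar> \<le> norm (act a x) * norm y" by (rule Cauchy_Schwarz_ineq2)
  also have "\<dots> \<le> (q2_norm a * norm x) * norm y"
    by (rule mult_right_mono[OF norm_act_le]) simp
  finally show ?thesis by (simp add: mult.assoc)
qed

text \<open>Along a Cauchy sequence \<open>X\<close> the coefficients converge, and by \<open>inner_act_le\<close> the limit depends
  only on the class of \<open>X\<close>. In particular it agrees with the limit along the representative that
  \<open>rep_q2\<close> happens to choose.\<close>

lemma matrix_coeff_limit:
  assumes X: "q2_cauchy X"
  shows "(\<lambda>n. act (X n) x \<bullet> y) \<longlonglongrightarrow> matrix_coeff x y (abs_q2 X)"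
proof -
  define Y where "Y = rep_q2 (abs_q2 X)"
  have "q2_seq_eq Y X"
    unfolding Y_def using X by (metis Quotient3_q2 q2_seq_eq_refl rep_abs_rsp_left)
  then have null: "(\<lambda>n. q2_norm (Y n - X n)) \<longlonglongrightarrow> 0" and Y: "q2_cauchy Y"
    by (auto simp: q2_seq_eq_def)
  have dist: "\<bar>act a x \<bullet> y - act b x \<bullet> y\<bar> \<le> q2_norm (a - b) * (norm x * norm y)" for a b
    using inner_act_le[of "a - b"] by (simp add: inner_diff_left)
  have "Cauchy (\<lambda>n. act (Y n) x \<bullet> y)"
    unfolding Cauchy_def dist_real_def
  proof (intro allI impI)
    fix e :: real assume "0 < e"
    define K where "K = norm x * norm y + 1"
    have K: "0 < K" "norm x * norm y \<le> K" by (auto simp: K_def add_nonneg_pos)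
    obtain N where N: "\<And>m n. m \<ge> N \<Longrightarrow> n \<ge> N \<Longrightarrow> q2_norm (Y m - Y n) < e / K"
      using Y \<open>0 < e\<close> K(1) unfolding q2_cauchy_def by (meson divide_pos_pos)
    have "\<bar>act (Y m) x \<bullet> y - act (Y n) x \<bullet> y\<bar> < e" if "m \<ge> N" "n \<ge> N" for m n
    proof -
      have "\<bar>act (Y m) x \<bullet> y - act (Y n) x \<bullet> y\<bar> \<le> q2_norm (Y m - Y n) * K"
        using dist[of "Y m" "Y n"] mult_left_mono[OF K(2) q2_norm_simps(1)] by (meson order_trans)
      also have "\<dots> < e" using N[OF that] K(1) by (simp add: field_simps)
      finally show ?thesis .
    qed
    then show "\<exists>M. \<forall>m\<ge>M. \<forall>n\<ge>M. \<bar>act (Y m) x \<bullet> y - act (Y n) x \<bullet> y\<bar> < e" by blast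
  qed
  then have "(\<lambda>n. act (Y n) x \<bullet> y) \<longlonglongrightarrow> matrix_coeff x y (abs_q2 X)"
    by (simp add: matrix_coeff_def Y_def Cauchy_convergent flip: convergent_LIMSEQ_iff)
  then have "(\<lambda>n. act (Y n) x \<bullet> y - (act (Y n) x \<bullet> y - act (X n) x \<bullet> y))
      \<longlonglongrightarrow> matrix_coeff x y (abs_q2 X) - 0"
  proof (rule tendsto_diff)
    show "(\<lambda>n. act (Y n) x \<bullet> y - act (X n) x \<bullet> y) \<longlonglongrightarrow> 0"
    by (rule Lim_null_comparison[OF always_eventually tendsto_mult_left_zero[OF null]])
      (use dist in auto)
  qed
  then show ?thesis by simp
qed

lemma matrix_coeff_of [simp]: "matrix_coeff x y (q2_of a) = act a x \<bullet> y"
  using matrix_coeff_limit[of "\<lambda>_. a"] unfolding q2_of_def by (simp add: LIMSEQ_const_iff)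

lemma matrix_coeff_diff_le:
  "\<bar>matrix_coeff x y T - matrix_coeff x y R\<bar> \<le> norm (T - R) * (norm x * norm y)"
proof -
  obtain X where X: "q2_cauchy X" "T = abs_q2 X" using q2_rep .
  obtain Y where Y: "q2_cauchy Y" "R = abs_q2 Y" using q2_rep .
  have 1: "(\<lambda>n. \<bar>act (X n) x \<bullet> y - act (Y n) x \<bullet> y\<bar>)
      \<longlonglongrightarrow> \<bar>matrix_coeff x y T - matrix_coeff x y R\<bar>"
    unfolding X(2) Y(2) by (intro tendsto_rabs tendsto_diff matrix_coeff_limit X Y)
  have 2: "(\<lambda>n. q2_norm (X n - Y n) * (norm x * norm y)) \<longlonglongrightarrow> norm (T - R) * (norm x * norm y)"
    using norm_q2_limit[OF q2_cauchy_diff[OF X(1) Y(1)]] X Y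
    by (intro tendsto_mult_right) (simp add: q2_abs_simps)
  show ?thesis
    by (rule LIMSEQ_le[OF 1 2]) (use inner_act_le[of "X _ - Y _"] in \<open>auto simp: inner_diff_left\<close>)
qed

lemma continuous_matrix_coeff: "continuous_on UNIV (matrix_coeff x y)"
  unfolding continuous_on_iff
proof (intro ballI allI impI)
  fix T e assume "0 < (e::real)"
  define K where "K = norm x * norm y + 1"
  have K: "0 < K" "norm x * norm y \<le> K" by (auto simp: K_def add_nonneg_pos)
  have "dist (matrix_coeff x y R) (matrix_coeff x y T) < e" if "dist R T < e / K" for R
  proof -
    have "dist (matrix_coeff x y R) (matrix_coeff x y T) \<le> norm (R - T) * (norm x * norm y)"
      unfolding dist_real_def by (rule matrix_coeff_diff_le)
    also have "\<dots> \<le> dist R T * K"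
      unfolding dist_norm by (rule mult_left_mono[OF K(2)]) simp
    also have "\<dots> < e" using that K(1) by (simp add: field_simps)
    finally show ?thesis .
  qed
  then show "\<exists>d>0. \<forall>R\<in>UNIV. dist R T < d \<longrightarrow> dist (matrix_coeff x y R) (matrix_coeff x y T) < e"
    using \<open>0 < e\<close> K(1) by (intro exI[of _ "e / K"]) simp
qed

lemma closure_range_q2_of: "closure (range q2_of) = UNIV"
proof -
  have "T \<in> closure (range q2_of)" for T
    by (metis closure_sequential q2_of_tendsto q2_rep rangeI)
  then show ?thesis by blast
qed

lemma q2_dense_eq:
  fixes f g :: "q2 \<Rightarrow> real"
  assumes "continuous_on UNIV f" "continuous_on UNIV g" "\<And>a. f (q2_of a) = g (q2_of a)"
  shows "f T = g T"
proof -
  have "closed {T. f T = g T}" by (rule closed_Collect_eq[OF assms(1,2)])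
  then have "closure (range q2_of) \<subseteq> {T. f T = g T}"
    by (rule closure_minimal[rotated]) (use assms(3) in auto)
  then show ?thesis using closure_range_q2_of by auto
qed

lemmas continuous_matrix_coeff_intros =
  continuous_on_compose2[OF continuous_matrix_coeff _ subset_UNIV] continuous_intros

lemma matrix_coeff_diff:
  "matrix_coeff x y (T - R) = matrix_coeff x y T - matrix_coeff x y R"
proof -
  have 1: "matrix_coeff x y (q2_of a - R) = act a x \<bullet> y - matrix_coeff x y R" for a
  proof (rule q2_dense_eq[where T = R])
    show "continuous_on UNIV (\<lambda>R. matrix_coeff x y (q2_of a - R))"
      "continuous_on UNIV (\<lambda>R. act a x \<bullet> y - matrix_coeff x y R)"
      by (intro continuous_matrix_coeff_intros)+
  qed (simp add: inner_diff_left flip: unital_star_homD(8)[OF q2_of_hom])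
  show ?thesis
  proof (rule q2_dense_eq[where T = T])
    show "continuous_on UNIV (\<lambda>T. matrix_coeff x y (T - R))"
      "continuous_on UNIV (\<lambda>T. matrix_coeff x y T - matrix_coeff x y R)"
      by (intro continuous_matrix_coeff_intros)+
  qed (simp add: 1)
qed

lemma matrix_coeff_mult_right:
  "matrix_coeff x y (T * q2_of a) = matrix_coeff (act a x) y T"
proof (rule q2_dense_eq[where T = T])
  show "continuous_on UNIV (\<lambda>T. matrix_coeff x y (T * q2_of a))"
    by (intro continuous_matrix_coeff_intros)
qed (simp_all add: continuous_matrix_coeff flip: unital_star_homD(3)[OF q2_of_hom])

lemma matrix_coeff_mult_left:
  "matrix_coeff x y (q2_of a * T) = matrix_coeff x (act (adj a) y) T"
proof (rule q2_dense_eq[where T = T])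
  show "continuous_on UNIV (\<lambda>T. matrix_coeff x y (q2_of a * T))"
    by (intro continuous_matrix_coeff_intros)
qed (simp_all add: continuous_matrix_coeff inner_act flip: unital_star_homD(3)[OF q2_of_hom])

lemma linear_matrix_coeff: "linear (\<lambda>x. matrix_coeff x y T)"
proof (rule linearI)
  fix x x' and r :: real
  show "matrix_coeff (x + x') y T = matrix_coeff x y T + matrix_coeff x' y T"
  proof (rule q2_dense_eq[where T = T])
    show "continuous_on UNIV (\<lambda>T. matrix_coeff x y T + matrix_coeff x' y T)"
      by (intro continuous_matrix_coeff_intros)
  qed (simp_all add: continuous_matrix_coeff inner_add_left linear_simps[OF bounded_linear_act])
  show "matrix_coeff (r *\<^sub>R x) y T = r *\<^sub>R matrix_coeff x y T"
  proof (rule q2_dense_eq[where T = T])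
    show "continuous_on UNIV (\<lambda>T. r *\<^sub>R matrix_coeff x y T)"
      by (intro continuous_matrix_coeff_intros)
  qed (simp_all add: continuous_matrix_coeff linear_simps[OF bounded_linear_act])
qed

section \<open>Averages of translations\<close>

text \<open>The operator \<open>W\<^sub>n = n\<^sup>-\<^sup>1\<^sup>/\<^sup>2 \<Sum> U\<^bsup>2^i\<^esup>\<close>, with \<open>i\<close> running over \<open>n \<le> i < 2n\<close>. Since
  \<open>S\<^sub>2 U\<^bsup>2^i\<^esup> = U\<^bsup>2^(i+1)\<^esup> S\<^sub>2\<close>, commuting with \<open>S\<^sub>2\<close> only shifts the range of summation by one, which
  is negligible after division by the square root of \<open>n\<close>. The range starts at \<open>n\<close> and not at \<open>0\<close> so
  that distinct exponents \<open>2^i\<close> are at distance at least \<open>2^n\<close>; then the translates of a finitely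
  supported sequence are eventually disjoint and \<open>W\<^sub>n\<close> is eventually isometric on it.\<close>

definition average :: "nat \<Rightarrow> finseq \<Rightarrow> finseq" where
  "average n x = (1 / sqrt n) *\<^sub>R (\<Sum>i = n..<2 * n. translate (2 ^ i) x)"

lemma bounded_linear_average: "bounded_linear (average n)"
  unfolding average_def
  by (intro bounded_linear_intros bounded_linear_translate)

lemma translate_basis: "translate m (basis k) = basis (k + m)"
  by (rule finseq_eqI) (auto simp: coeff_basis)

lemma translate_cscale: "translate m (cscale c x) = cscale c (translate m x)"
  by (rule finseq_eqI) simp

lemma average_cscale: "average n (cscale c x) = cscale c (average n x)"
  by (simp add: average_def translate_cscale cscale_scaleR
      linear_sum[OF bounded_linear.linear[OF bounded_linear_cscale]])

lemma power2_gap: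
  assumes "n \<le> i" "n \<le> j" "i \<noteq> j" shows "(2::int) ^ n \<le> \<bar>2 ^ i - 2 ^ j\<bar>"
proof -
  have *: "(2::int) ^ n \<le> 2 ^ j - 2 ^ i" if "n \<le> i" "i < j" for i j
  proof -
    have "(2::int) ^ n \<le> 2 ^ i" using that by (intro power_increasing) auto
    moreover have "(2::int) ^ Suc i \<le> 2 ^ j" using that by (intro power_increasing) auto
    ultimately show ?thesis unfolding power_Suc by linarith
  qed
  show ?thesis using *[of i j] *[of j i] assms by (cases i j rule: linorder_cases) auto
qed

text \<open>In the double sum the diagonal terms contribute \<open>n\<close> copies of \<open>\<langle>x, e\<^sub>l\<rangle>\<close>. An off-diagonal term is
  a coefficient of \<open>x\<close> at distance at least \<open>2^n\<close> from \<open>l\<close>, hence zero once \<open>2^n\<close> exceeds the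
  width of the support.\<close>

lemma inner_average_basis:
  "\<forall>\<^sub>F n in sequentially. average n x \<bullet> average n (basis l) = x \<bullet> basis l"
proof -
  obtain M where M: "\<And>k. coeff x k \<noteq> 0 \<Longrightarrow> \<bar>k - l\<bar> < int M"
  proof
    fix k assume "coeff x k \<noteq> 0"
    then have "\<bar>k - l\<bar> \<le> Max ((\<lambda>k. \<bar>k - l\<bar>) ` {k. coeff x k \<noteq> 0})"
      by (intro Max_ge) (auto simp: finite_support)
    then show "\<bar>k - l\<bar> < int (nat (Max ((\<lambda>k. \<bar>k - l\<bar>) ` {k. coeff x k \<noteq> 0}) + 1))"
      by linarith
  qed
  show ?thesis
  proof (rule eventually_sequentiallyI[of "Suc M"])
    fix n assume n: "Suc M \<le> n"
    have "int M < 2 ^ M" by (metis less_exp of_nat_less_iff of_nat_numeral of_nat_power)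
    also have "\<dots> \<le> (2::int) ^ n" using n by (intro power_increasing) auto
    finally have Mn: "int M < 2 ^ n" .
    have "(\<Sum>j = n..<2 * n. translate (2 ^ i) x \<bullet> translate (2 ^ j) (basis l)) = Re (coeff x l)"
      if i: "i \<in> {n..<2 * n}" for i
    proof -
      have "translate (2 ^ i) x \<bullet> translate (2 ^ j) (basis l)
          = (if j = i then Re (coeff x l) else 0)" if j: "j \<in> {n..<2 * n}" for j
      proof (cases "j = i")
        case False
        then have "(2::int) ^ n \<le> \<bar>2 ^ j - 2 ^ i\<bar>" using power2_gap[of n j i] i j by simp
        with Mn have "int M \<le> \<bar>2 ^ j - 2 ^ i\<bar>" by linarith
        then have "coeff x (l + 2 ^ j - 2 ^ i) = 0" using M[of "l + 2 ^ j - 2 ^ i"] by force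
        then show ?thesis using False by (simp add: translate_basis inner_basis)
      qed (simp add: translate_basis inner_basis)
      then show ?thesis using i by simp
    qed
    then have "(\<Sum>i = n..<2 * n. translate (2 ^ i) x) \<bullet>
        (\<Sum>j = n..<2 * n. translate (2 ^ j) (basis l)) = n * Re (coeff x l)"
      unfolding inner_sum_left unfolding inner_sum_right by simp
    then show "average n x \<bullet> average n (basis l) = x \<bullet> basis l"
      using n by (simp add: average_def inner_basis)
  qed
qed

lemma norm_average_basis: "\<forall>\<^sub>F n in sequentially. norm (average n (basis k)) = 1"
  using inner_average_basis[of "basis k" k]
  by eventually_elim (simp add: norm_eq_sqrt_inner inner_basis coeff_basis)

text \<open>The convergence is only required pointwise: the operators \<open>W\<^sub>n\<close> are not uniformly bounded.\<close>

definition asymp_commutes :: "(finseq \<Rightarrow> finseq) \<Rightarrow> bool" where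
  "asymp_commutes A \<longleftrightarrow> (\<forall>x. (\<lambda>n. A (average n x) - average n (A x)) \<longlonglongrightarrow> 0)"

text \<open>The two boundary terms of a telescoping sum have norm at most \<open>\<parallel>Ax\<parallel>\<close> each, so the scalar
  \<open>n\<^sup>-\<^sup>1\<^sup>/\<^sup>2\<close> drives the commutator to zero.\<close>

lemma asymp_commutes_telescope:
  assumes "\<forall>\<^sub>F n in sequentially. \<forall>x. A (average n x) - average n (A x) =
     (1 / sqrt n) *\<^sub>R (translate (f n) (A x) - translate (g n) (A x))"
  shows "asymp_commutes A"
  unfolding asymp_commutes_def
proof
  fix x
  have "(\<lambda>n. 1 / sqrt (real n)) \<longlonglongrightarrow> 0"
    using tendsto_inverse_0_at_top[OF filterlim_compose[OF sqrt_at_top filterlim_real_sequentially]]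
    by (simp add: divide_inverse)
  then have lim: "(\<lambda>n. 1 / sqrt (real n) * (2 * norm (A x))) \<longlonglongrightarrow> 0"
    by (rule tendsto_mult_left_zero)
  have "\<forall>\<^sub>F n in sequentially.
      norm (A (average n x) - average n (A x)) \<le> 1 / sqrt (real n) * (2 * norm (A x))"
    using assms
  proof eventually_elim
    case (elim n)
    have "norm (translate (f n) (A x) - translate (g n) (A x)) \<le> 2 * norm (A x)"
      using norm_triangle_ineq4[of "translate (f n) (A x)" "translate (g n) (A x)"]
      by (simp add: norm_translate)
    then show ?case using elim[rule_format, of x] by (simp add: divide_right_mono)
  qed
  then show "(\<lambda>n. A (average n x) - average n (A x)) \<longlonglongrightarrow> 0"
    by (rule Lim_null_comparison[OF _ lim])
qed

lemma dilate_translate: "dilate (translate m x) = translate (2 * m) (dilate x)"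
  by (rule finseq_eqI) auto

lemma contract_translate: "contract (translate (2 * m) x) = translate m (contract x)"
  by (rule finseq_eqI) (simp add: algebra_simps)

lemma asymp_commutes_dilate: "asymp_commutes dilate"
proof (rule asymp_commutes_telescope[OF always_eventually], intro allI)
  fix n x
  have "dilate (average n x) =
      (1 / sqrt n) *\<^sub>R (\<Sum>i = n..<2 * n. translate (2 ^ Suc i) (dilate x))"
    by (simp add: average_def linear_simps[OF bounded_linear_dilate] dilate_translate
        linear_sum[OF bounded_linear.linear[OF bounded_linear_dilate]])
  then show "dilate (average n x) - average n (dilate x) =
      (1 / sqrt n) *\<^sub>R (translate (2 ^ (2 * n)) (dilate x) - translate (2 ^ n) (dilate x))"
    using sum_Suc_diff'[of n "2 * n" "\<lambda>i. translate (2 ^ i) (dilate x)"]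
    by (simp add: average_def scaleR_diff_right[symmetric] sum_subtractf[symmetric])
qed

lemma asymp_commutes_contract: "asymp_commutes contract"
proof (rule asymp_commutes_telescope[OF eventually_sequentiallyI[of 1]], intro allI)
  fix n :: nat and x assume n: "1 \<le> n"
  have *: "contract (translate (2 ^ i) x) = translate (2 ^ (i - 1)) (contract x)" if "n \<le> i" for i
    using contract_translate[of "2 ^ (i - 1)" x] n that by (simp flip: power_Suc)
  have "contract (average n x) =
      (1 / sqrt n) *\<^sub>R (\<Sum>i = n..<2 * n. translate (2 ^ (i - 1)) (contract x))"
    by (simp add: average_def linear_simps[OF bounded_linear_contract] *
        linear_sum[OF bounded_linear.linear[OF bounded_linear_contract]])
  then show "contract (average n x) - average n (contract x) = (1 / sqrt n) *\<^sub>R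
      (translate (2 ^ (n - 1)) (contract x) - translate (2 ^ (2 * n - 1)) (contract x))"
    using sum_Suc_diff'[of n "2 * n" "\<lambda>i. - translate (2 ^ (i - 1)) (contract x)"]
    by (simp add: average_def scaleR_diff_right[symmetric] sum_subtractf[symmetric])
qed

lemma asymp_commutes_translate: "asymp_commutes (translate m)"
proof -
  have "translate m (average n x) = average n (translate m x)" for n x
    by (simp add: average_def linear_simps[OF bounded_linear_translate] translate_translate
        add.commute linear_sum[OF bounded_linear.linear[OF bounded_linear_translate]])
  then show ?thesis by (simp add: asymp_commutes_def)
qed

lemma asymp_commutes_add:
  assumes "asymp_commutes A" "asymp_commutes B" shows "asymp_commutes (\<lambda>x. A x + B x)"
  unfolding asymp_commutes_def
proof
  fix x
  show "(\<lambda>n. (A (average n x) + B (average n x)) - average n (A x + B x)) \<longlonglongrightarrow> 0"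
    using tendsto_add[OF assms[unfolded asymp_commutes_def, rule_format, of x]]
    by (simp add: linear_simps[OF bounded_linear_average] algebra_simps)
qed

lemma asymp_commutes_cscale:
  assumes "asymp_commutes A" shows "asymp_commutes (\<lambda>x. cscale c (A x))"
  unfolding asymp_commutes_def
proof
  fix x
  show "(\<lambda>n. cscale c (A (average n x)) - average n (cscale c (A x))) \<longlonglongrightarrow> 0"
    using bounded_linear.tendsto[OF bounded_linear_cscale[of c]
        assms[unfolded asymp_commutes_def, rule_format, of x]]
    by (simp add: linear_simps[OF bounded_linear_cscale] average_cscale)
qed

lemma asymp_commutes_compose:
  assumes "bounded_linear A" "asymp_commutes A" "asymp_commutes B"
  shows "asymp_commutes (\<lambda>x. A (B x))"
  unfolding asymp_commutes_def
proof
  fix x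
  have "(\<lambda>n. A (B (average n x) - average n (B x)) + (A (average n (B x)) - average n (A (B x))))
      \<longlonglongrightarrow> A 0 + 0"
    by (intro tendsto_add bounded_linear.tendsto[OF assms(1)])
      (use assms(2,3) in \<open>auto simp: asymp_commutes_def\<close>)
  then show "(\<lambda>n. A (B (average n x)) - average n (A (B x))) \<longlonglongrightarrow> 0"
    by (simp add: linear_simps[OF assms(1)])
qed

text \<open>The operators commuting asymptotically with the averages form an algebra, but the property does
  not obviously pass to adjoints. The induction therefore carries \<open>a\<close> and its adjoint together.\<close>

lemma asymp_commutes_act: "asymp_commutes (act a)"
proof -
  have zero: "asymp_commutes (\<lambda>x. 0)" and one: "asymp_commutes (\<lambda>x. x)"
    by (simp_all add: asymp_commutes_def linear_simps[OF bounded_linear_average])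
  have minus: "asymp_commutes (\<lambda>x. - A x)" if "asymp_commutes A" for A
  proof -
    have "(\<lambda>x. - A x) = (\<lambda>x. cscale (- 1) (A x))" by (intro ext finseq_eqI) simp
    then show ?thesis using asymp_commutes_cscale[OF that, of "- 1"] by simp
  qed
  have ext: "act 0 = (\<lambda>x. 0)" "act 1 = (\<lambda>x. x)" "act (a + b) = (\<lambda>x. act a x + act b x)"
    "act (- a) = (\<lambda>x. - act a x)" "act (a * b) = (\<lambda>x. act a (act b x))"
    "act (c *\<^sub>C a) = (\<lambda>x. cscale c (act a x))" for a b c
    by (simp_all add: fun_eq_iff)
  have compose: "asymp_commutes (\<lambda>x. act a (act b x))"
    if "asymp_commutes (act a)" "asymp_commutes (act b)" for a b
    by (rule asymp_commutes_compose[OF bounded_linear_act that])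
  have "asymp_commutes (act a) \<and> asymp_commutes (act (adj a))"
    by (induction a rule: q2_alg_induct)
      (simp_all add: ext adj_add adj_minus adj_mult adj_scaleC adj_adj zero one minus compose
        asymp_commutes_translate asymp_commutes_dilate asymp_commutes_contract
        asymp_commutes_add asymp_commutes_cscale)
  then show ?thesis ..
qed

lemma act_average_limit:
  "(\<lambda>n. act a (average n (basis k)) \<bullet> average n (basis l)) \<longlonglongrightarrow> act a (basis k) \<bullet> basis l"
proof -
  let ?d = "\<lambda>n. act a (average n (basis k)) - average n (act a (basis k))"
  have "?d \<longlonglongrightarrow> 0" using asymp_commutes_act by (simp add: asymp_commutes_def)
  then have "(\<lambda>n. norm (?d n)) \<longlonglongrightarrow> 0" by (rule tendsto_norm_zero)
  then have "(\<lambda>n. ?d n \<bullet> average n (basis l)) \<longlonglongrightarrow> 0"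
  proof (rule Lim_null_comparison[rotated])
    show "\<forall>\<^sub>F n in sequentially. norm (?d n \<bullet> average n (basis l)) \<le> norm (?d n)"
      using norm_average_basis[of l]
    proof eventually_elim
      case (elim n)
      then show ?case using Cauchy_Schwarz_ineq2[of "?d n" "average n (basis l)"] by simp
    qed
  qed
  moreover have "(\<lambda>n. average n (act a (basis k)) \<bullet> average n (basis l))
      \<longlonglongrightarrow> act a (basis k) \<bullet> basis l"
    by (rule tendsto_eventually[OF inner_average_basis])
  ultimately have "(\<lambda>n. ?d n \<bullet> average n (basis l)
      + average n (act a (basis k)) \<bullet> average n (basis l)) \<longlonglongrightarrow> 0 + act a (basis k) \<bullet> basis l"
    by (rule tendsto_add)
  then show ?thesis by (simp add: inner_diff_left)
qed

text \<open>Moving basis vectors far to the right by the averages is invisible to all of the 2-adic ring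
  C*-algebra in the limit. As \<open>W\<^sub>n e\<^sub>k\<close> tends weakly to zero, the left-hand side would tend to zero for a
  compact operator, so this is a concrete form of the fact that the representation contains no
  nonzero compact operator.\<close>

lemma matrix_coeff_average_limit:
  "(\<lambda>n. matrix_coeff (average n (basis k)) (average n (basis l)) T)
    \<longlonglongrightarrow> matrix_coeff (basis k) (basis l) T"
proof (rule tendstoI)
  fix e :: real assume "0 < e"
  have "T \<in> closure (range q2_of)" by (simp add: closure_range_q2_of)
  then obtain a where a: "dist (q2_of a) T < e / 3"
    using \<open>0 < e\<close> by (metis closure_approachable divide_pos_pos imageE zero_less_numeral)
  have near: "\<bar>matrix_coeff x y T - act a x \<bullet> y\<bar> < e / 3" if "norm x = 1" "norm y = 1" for x y
    using matrix_coeff_diff_le[of x y T "q2_of a"] a that by (simp add: dist_norm norm_minus_commute)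
  have "\<forall>\<^sub>F n in sequentially.
      dist (act a (average n (basis k)) \<bullet> average n (basis l)) (act a (basis k) \<bullet> basis l) < e / 3"
    using act_average_limit \<open>0 < e\<close> by (intro tendstoD) auto
  then show "\<forall>\<^sub>F n in sequentially. dist (matrix_coeff (average n (basis k)) (average n (basis l)) T)
      (matrix_coeff (basis k) (basis l) T) < e"
    using norm_average_basis[of k] norm_average_basis[of l]
  proof eventually_elim
    case (elim n)
    show ?case
      using near[OF elim(2,3)] near[OF norm_basis norm_basis, of k l] elim(1)
      unfolding dist_real_def by linarith
  qed
qed

section \<open>The Cuntz algebra\<close>

text \<open>Scalar multiplication and the involution are Lipschitz maps, hence preserve closures; addition and
  multiplication are jointly continuous.\<close>

lemma cstar_subalgebra_closure:
  fixes A :: "'a::unital_cstar_algebra set"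
  assumes zero: "0 \<in> A" and add: "\<And>x y. x \<in> A \<Longrightarrow> y \<in> A \<Longrightarrow> x + y \<in> A"
    and mult: "\<And>x y. x \<in> A \<Longrightarrow> y \<in> A \<Longrightarrow> x * y \<in> A"
    and scale: "\<And>c x. x \<in> A \<Longrightarrow> c *\<^sub>C x \<in> A" and adj: "\<And>x. x \<in> A \<Longrightarrow> adj x \<in> A"
  shows "cstar_subalgebra (closure A)"
proof -
  have lipschitz: "f x \<in> closure A"
    if x: "x \<in> closure A" and f: "\<And>x. x \<in> A \<Longrightarrow> f x \<in> A" "\<And>x y. norm (f x - f y) \<le> K * norm (x - y)"
    for f :: "'a \<Rightarrow> 'a" and K x
  proof -
    obtain X where X: "\<And>n. X n \<in> A" "X \<longlonglongrightarrow> x" using x unfolding closure_sequential by blast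
    have "(\<lambda>n. K * norm (X n - x)) \<longlonglongrightarrow> 0"
      by (rule tendsto_mult_right_zero[OF tendsto_norm_zero[OF LIM_zero[OF X(2)]]])
    then have "(\<lambda>n. f (X n) - f x) \<longlonglongrightarrow> 0"
      by (rule Lim_null_comparison[OF always_eventually, rotated]) (simp add: f(2))
    then have "(\<lambda>n. f (X n)) \<longlonglongrightarrow> f x" by (rule LIM_zero_cancel)
    then show ?thesis
      unfolding closure_sequential by (intro exI[of _ "\<lambda>n. f (X n)"]) (simp add: f(1) X(1))
  qed
  show ?thesis
    unfolding cstar_subalgebra_def
  proof (intro conjI ballI allI)
    show "0 \<in> closure A" using zero closure_subset by blast
    fix x assume x: "x \<in> closure A"
    show "c *\<^sub>C x \<in> closure A" for c
      by (rule lipschitz[OF x, where f = "\<lambda>x. c *\<^sub>C x" and K = "cmod c"])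
        (simp_all add: scale norm_scaleC flip: scaleC_diff_right)
    show "adj x \<in> closure A"
      by (rule lipschitz[OF x, where f = adj and K = 1]) (simp_all add: adj norm_adj flip: adj_diff)
    fix y assume y: "y \<in> closure A"
    obtain X where X: "\<And>n. X n \<in> A" "X \<longlonglongrightarrow> x" using x unfolding closure_sequential by blast
    obtain Y where Y: "\<And>n. Y n \<in> A" "Y \<longlonglongrightarrow> y" using y unfolding closure_sequential by blast
    show "x + y \<in> closure A"
      unfolding closure_sequential
      by (intro exI[of _ "\<lambda>n. X n + Y n"] conjI allI tendsto_add X Y add)
    show "x * y \<in> closure A"
      unfolding closure_sequential
      by (intro exI[of _ "\<lambda>n. X n * Y n"] conjI allI tendsto_mult X Y mult)
  qed simp
qed

definition negatively_supported :: "finseq \<Rightarrow> bool" where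
  "negatively_supported x \<longleftrightarrow> (\<forall>k\<ge>0. coeff x k = 0)"

text \<open>The maps \<open>k \<mapsto> 2k\<close> and \<open>k \<mapsto> 2k + 1\<close> preserve the negative integers and the nonnegative ones, so
  \<open>\<ell>\<^sup>2(\<int>)\<close> splits into two reducing subspaces for the Cuntz algebra. The unitary \<open>U\<close> does not respect
  this splitting, as it moves \<open>-1\<close> to \<open>0\<close>.\<close>

lemma matrix_coeff_cuntz_O2:
  assumes "T \<in> cuntz_O2" "k < 0" "0 \<le> l"
  shows "matrix_coeff (basis k) (basis l) T = 0"
proof -
  let ?N = negatively_supported
  \<comment> \<open>The adjoint is included because a generated C*-subalgebra is closed under the involution.\<close>
  define A where "A = {a. \<forall>x. ?N x \<longrightarrow> ?N (act a x) \<and> ?N (act (adj a) x)}"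
  have "cstar_subalgebra (closure (q2_of ` A))"
  proof (rule cstar_subalgebra_closure)
    note hom = unital_star_homD[OF q2_of_hom]
    have "0 \<in> A" by (simp add: A_def negatively_supported_def)
    then show "0 \<in> q2_of ` A" by (rule image_eqI[rotated]) (simp add: hom)
    fix c v assume "v \<in> q2_of ` A"
    then obtain a where a: "a \<in> A" "v = q2_of a" by blast
    have "c *\<^sub>C a \<in> A" "adj a \<in> A"
      using a(1) by (simp_all add: A_def negatively_supported_def adj_scaleC adj_adj)
    then show "c *\<^sub>C v \<in> q2_of ` A" "adj v \<in> q2_of ` A"
      unfolding a(2) hom(4,5)[symmetric] by blast+
    fix w assume "w \<in> q2_of ` A"
    then obtain b where b: "b \<in> A" "w = q2_of b" by blast
    have "a + b \<in> A" "a * b \<in> A"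
      using a(1) b(1) by (simp_all add: A_def negatively_supported_def adj_add adj_mult)
    then show "v + w \<in> q2_of ` A" "v * w \<in> q2_of ` A"
      unfolding a(2) b(2) hom(2,3)[symmetric] by blast+
  qed
  moreover have "{q2_S1, q2_S2} \<subseteq> q2_of ` A"
  proof -
    have "alg_S \<in> A" "alg_U * alg_S \<in> A"
      by (auto simp: A_def negatively_supported_def adj_mult elim: oddE)
    then show ?thesis
      by (auto simp: q2_S1_def q2_S2_def q2_U_def simp flip: unital_star_homD(3)[OF q2_of_hom])
  qed
  ultimately have "cuntz_O2 \<subseteq> closure (q2_of ` A)"
    unfolding cuntz_O2_def cstar_generated_def
    by (intro Inter_lower CollectI conjI subset_trans[OF _ closure_subset])
  also have "\<dots> \<subseteq> {T. matrix_coeff (basis k) (basis l) T = 0}"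
  proof (rule closure_minimal)
    have "?N (basis k)" using assms(2) by (simp add: negatively_supported_def coeff_basis)
    then show "q2_of ` A \<subseteq> {T. matrix_coeff (basis k) (basis l) T = 0}"
      using assms(3) by (auto simp: A_def negatively_supported_def inner_basis)
    show "closed {T. matrix_coeff (basis k) (basis l) T = 0}"
      by (intro closed_Collect_eq continuous_matrix_coeff continuous_on_const)
  qed
  finally show ?thesis using assms(1) by blast
qed

section \<open>Conditional expectation\<close>

text \<open>The relations say \<open>D e\<^bsub>2j\<^esub> = 0\<close> and \<open>D e\<^bsub>2j+1\<^esub> = S\<^sub>2 D e\<^sub>j\<close>, and \<open>j < 2j + 1\<close> for \<open>j \<ge> 0\<close>. The
  only integer at which this recursion does not terminate in an even number is the fixed point
  \<open>j = 2j + 1\<close>, that is \<open>j = -1\<close>.\<close>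

lemma matrix_coeff_nonneg_eq_0:
  assumes D: "D * q2_S2 = 0" "D * q2_S1 = q2_S2 * D" and "0 \<le> k"
  shows "matrix_coeff (basis k) y D = 0"
  using \<open>0 \<le> k\<close>
proof (induction "nat k" arbitrary: k y rule: less_induct)
  case less
  have S2: "act alg_S (basis j) = basis (2 * j)" for j
    by (rule finseq_eqI) (auto simp: coeff_basis)
  have S1: "act (alg_U * alg_S) (basis j) = basis (2 * j + 1)" for j
    using S2[of j] by (simp add: translate_basis)
  have zero: "matrix_coeff x y 0 = 0" for x y
    using matrix_coeff_diff[of x y 0 0] by simp
  show ?case
  proof (cases "even k")
    case True
    then obtain j where "k = 2 * j" by (elim evenE)
    then show ?thesis
      using matrix_coeff_mult_right[of "basis j" y D alg_S] D(1) S2[of j] zero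
      by (simp add: q2_S2_def)
  next
    case False
    then obtain j where j: "k = 2 * j + 1" by (elim oddE)
    have "matrix_coeff (basis k) y D = matrix_coeff (basis j) y (D * q2_S1)"
      using matrix_coeff_mult_right[of "basis j" y D "alg_U * alg_S"] S1[of j] j
      by (simp add: q2_S1_def q2_S2_def q2_U_def unital_star_homD(3)[OF q2_of_hom])
    also have "\<dots> = matrix_coeff (basis j) (contract y) D"
      unfolding D(2) q2_S2_def matrix_coeff_mult_left by simp
    also have "\<dots> = 0" using less j by (intro less(1)) auto
    finally show ?thesis .
  qed
qed

text \<open>The remaining column of \<open>D\<close> is reached by the averages: all translates of \<open>e\<^bsub>-1\<^esub>\<close> by \<open>2^i\<close> lie
  among the nonnegative basis vectors, which \<open>D\<close> annihilates.\<close>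

lemma matrix_coeff_minus_one_eq_0:
  assumes "D * q2_S2 = 0" "D * q2_S1 = q2_S2 * D"
  shows "matrix_coeff (basis (- 1)) (basis l) D = 0"
proof -
  have "matrix_coeff (average n (basis (- 1))) y D = 0" for n y
  proof -
    have "matrix_coeff (basis (- 1 + 2 ^ i)) y D = 0" for i
      by (rule matrix_coeff_nonneg_eq_0[OF assms]) simp
    then show ?thesis
      by (simp add: average_def translate_basis linear_sum[OF linear_matrix_coeff]
          linear_scale[OF linear_matrix_coeff])
  qed
  then show ?thesis
    using matrix_coeff_average_limit[of "- 1" l D] by (simp add: LIMSEQ_const_iff)
qed

theorem theorem3p16:
  "\<not> (\<exists>E :: q2 \<Rightarrow> q2. conditional_expectation cuntz_O2 E \<and> E 1 = 1)"
proof
  assume "\<exists>E. conditional_expectation cuntz_O2 E \<and> E 1 = 1"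
  then obtain E where E: "range E = cuntz_O2" "\<And>b. b \<in> cuntz_O2 \<Longrightarrow> E b = b"
      "\<And>b b' x. b \<in> cuntz_O2 \<Longrightarrow> b' \<in> cuntz_O2 \<Longrightarrow> E (b * x * b') = b * E x * b'"
      and E1: "E 1 = 1"
    unfolding conditional_expectation_def by blast
  have one: "1 \<in> cuntz_O2" using E(1) E1 by (metis rangeI)
  have S: "q2_S1 \<in> cuntz_O2" "q2_S2 \<in> cuntz_O2"
    by (auto simp: cuntz_O2_def cstar_generated_def)
  \<comment> \<open>\<open>U\<close> intertwines as \<open>U S\<^sub>2 = S\<^sub>1\<close> and \<open>U S\<^sub>1 = S\<^sub>2 U\<close>; both identities survive the bimodule map \<open>E\<close>.\<close>
  have US1: "q2_U * q2_S1 = q2_S2 * q2_U"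
    using q2_generators_relations
    by (simp add: q2_S1_def q2_relations_def power2_eq_square mult.assoc)
  have 1: "E q2_U * q2_S2 = q2_S1"
    using E(3)[OF one S(2), of q2_U] E(2)[OF S(1)] by (simp add: q2_S1_def)
  have 2: "E q2_U * q2_S1 = q2_S2 * E q2_U"
    using E(3)[OF one S(1), of q2_U] E(3)[OF S(2) one, of q2_U] by (simp add: US1)
  define D where "D = q2_U - E q2_U"
  have "D * q2_S2 = 0" "D * q2_S1 = q2_S2 * D"
    by (simp_all add: D_def algebra_simps 1 2 US1) (simp add: q2_S1_def)
  then have "matrix_coeff (basis (- 1)) (basis 0) D = 0"
    by (rule matrix_coeff_minus_one_eq_0)
  moreover have "matrix_coeff (basis (- 1)) (basis 0) (E q2_U) = 0"
    using E(1) by (intro matrix_coeff_cuntz_O2) auto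
  moreover have "matrix_coeff (basis (- 1)) (basis 0) q2_U = 1"
    by (simp add: q2_U_def translate_basis inner_basis coeff_basis)
  ultimately show False by (simp add: D_def matrix_coeff_diff)
qed

end
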